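(* Let $E\subset\mathbb{R}^d$ be a non-autonomous affine set determined by matrices $T_{k,j}$ ($k\ge1$, $1\le j\le n_k$) satisfying the standing assumption $0<\alpha_-\le\alpha_+<1$ (see context), and let $$s^*=\inf\Big\{s>0:\limsup_{\epsilon\to0}\sum_{\mathbf u\in\Sigma^*(s,\epsilon)}\phi^s(T_{\mathbf u})<\infty\Big\}.$$ Then $$\overline{\dim}_{\rm B}E\le\min\{s^*,d\}.$$
   Context: Let $\{n_k\}_{k\ge1}$ be integers with $n_k\ge2$. Put $\Sigma^k=\{u_1\cdots u_k:1\le u_j\le n_j\}$, $\Sigma^0=\{\emptyset\}$, $\Sigma^*=\bigcup_{k\ge0}\Sigma^k$. Let $J\subset\mathbb{R}^d$ be compact with non-empty interior. For each $k\ge1$ let $\Xi_k=\{T_{k,1},\dots,T_{k,n_k}\}$ be a collection of real $d\times d$ matrices with $\|T_{k,j}\|<1$. For $\mathbf u=u_1\cdots u_k$ write $T_{\mathbf u}=T_{1,u_1}\cdots T_{k,u_k}$ and $\mathbf u^-=u_1\cdots u_{k-1}$ ($T_\emptyset$ is the identity). Non-autonomous affine set: let $\mathcal{J}=\{J_{\mathbf u}:\mathbf u\in\Sigma^*\}$ be a collection of closed subsets of $J$ such that (1) $J_\emptyset=J$ and for all $k\ge1$, $\mathbf u\in\Sigma^{k-1}$, the sets $J_{\mathbf u1},\dots,J_{\mathbf un_k}$ are subsets of $J_{\mathbf u}$; (2) there are vectors $\omega_{\mathbf v}\in\mathbb{R}^d$ ($\mathbf v\in\Sigma^*\setminus\{\emptyset\}$)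 such that $J_{\mathbf u}=\Psi_{\mathbf u}(J)=\Psi_{u_1}\circ\cdots\circ\Psi_{u_k}(J)$ for each $\mathbf u=u_1\cdots u_k$, where $\Psi_{u_j}(x)=T_{j,u_j}x+\omega_{u_1\cdots u_j}$; (3) $\lim_{k\to\infty}\max_{\mathbf u\in\Sigma^k}\operatorname{diam}J_{\mathbf u}=0$. Then $E=\bigcap_{k\ge1}\bigcup_{\mathbf u\in\Sigma^k}J_{\mathbf u}$ is the non-autonomous affine set determined by $\mathcal{J}$. Singular values of a matrix $T$ are $\alpha_1(T)\ge\dots\ge\alpha_d(T)$. Standing assumption: all $T_{k,i}$ are nonsingular and $0<\alpha_-\le\alpha_+<1$, where $\alpha_+=\sup_{k,i}\alpha_1(T_{k,i})$, $\alpha_-=\inf_{k,i}\alpha_d(T_{k,i})$. Singular value function: for $0<s\le d$, $\phi^s(T)=\alpha_1(T)\cdots\alpha_{m-1}(T)\alpha_m(T)^{s-m+1}$ with $m$ the integer such that $m-1<s\le m$; $\phi^0(T)=1$; for $s>d$, $\phi^s(T)=(\alpha_1(T)\cdots\alpha_d(T))^{s/d}$. For $s>0$, $0<\epsilon<1$ and $m$ the integer with $m-1<s\le m$, $\Sigma^*(s,\epsilon)=\{\mathbf u\in\Sigma^*\setminus\{\emptyset\}:\alpha_m(T_{\mathbf u})\le\epsilon<\alpha_m(T_{\mathbf u^-})\}$, with the convention $\alpha_m=\alpha_d$ when $m>d$. $\overline{\dim}_{\rm B}$ is upper box-counting dimension. *)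

theory Defs
  imports
    "HOL-Analysis.Analysis"
    "HOL-Computational_Algebra.Polynomial"
    "HOL-Library.Multiset"
begin

definition charpoly :: "real ^ 'd ^ 'd \<Rightarrow> real poly" where
  "charpoly A = det (\<chi> i j. (if i = j then [:0, 1:] else 0) - [:A $ i $ j:])"

text \<open>
  All singular values, repeated according to multiplicity and in decreasing order. The matrix
  \<^term>\<open>transpose T ** T\<close> is symmetric and positive semidefinite, so its characteristic polynomial
  splits over the reals, its roots are nonnegative, and the list has length \<^term>\<open>CARD('d)\<close>.
\<close>

definition singular_values :: "real ^ 'd ^ 'd \<Rightarrow> real list" where
  "singular_values T =
     rev (sorted_list_of_multiset (image_mset sqrt (proots (charpoly (transpose T ** T)))))"

text \<open>Meaningful for \<open>1 \<le> i \<le> CARD('d)\<close>.\<close>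

definition singular_value :: "nat \<Rightarrow> real ^ 'd ^ 'd \<Rightarrow> real" where
  "singular_value i T = singular_values T ! (i - 1)"

text \<open>For \<open>s > 0\<close>, the integer \<open>m = nat \<lceil>s\<rceil>\<close> is the one with \<open>m - 1 < s \<le> m\<close>.\<close>

definition singular_value_function :: "real \<Rightarrow> real ^ 'd ^ 'd \<Rightarrow> real" where
  "singular_value_function s T =
     (if s = 0 then 1
      else if s \<le> real CARD('d) then
        (let m = nat \<lceil>s\<rceil> in
          (\<Prod>i = 1..<m. singular_value i T) * singular_value m T powr (s - real m + 1))
      else (\<Prod>i = 1..CARD('d). singular_value i T) powr (s / real CARD('d)))"

text \<open>
  Words are lists whose \<open>j\<close>-th letter (counted from 1) is \<open>u ! (j - 1) \<in> {1..n j}\<close>.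
  The values \<open>n 0\<close>, \<open>T 0 j\<close>, and \<open>T k j\<close> for \<open>j \<notin> {1..n k}\<close> are never used.
\<close>

definition words :: "(nat \<Rightarrow> nat) \<Rightarrow> nat \<Rightarrow> nat list set" where
  "words n k = {u. length u = k \<and> (\<forall>j\<in>{1..k}. u ! (j - 1) \<in> {1..n j})}"

definition all_words :: "(nat \<Rightarrow> nat) \<Rightarrow> nat list set" where
  "all_words n = (\<Union>k. words n k)"

definition word_matrix :: "(nat \<Rightarrow> nat \<Rightarrow> real ^ 'd ^ 'd) \<Rightarrow> nat list \<Rightarrow> real ^ 'd ^ 'd" where
  "word_matrix T u = foldr (**) (map (\<lambda>j. T j (u ! (j - 1))) [1..<Suc (length u)]) (mat 1)"

text \<open>
  For a nonempty word \<open>v = u\<^sub>1 \<dots> u\<^sub>j\<close> the map \<open>\<Psi>\<close> attached to the letter \<open>u\<^sub>j\<close> depends on all of \<open>v\<close>,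
  since the translation is \<open>\<omega> v\<close>.
\<close>

definition letter_map ::
  "(nat \<Rightarrow> nat \<Rightarrow> real ^ 'd ^ 'd) \<Rightarrow> (nat list \<Rightarrow> real ^ 'd) \<Rightarrow> nat list \<Rightarrow> real ^ 'd \<Rightarrow> real ^ 'd"
where
  "letter_map T \<omega> v x = T (length v) (last v) *v x + \<omega> v"

definition word_map ::
  "(nat \<Rightarrow> nat \<Rightarrow> real ^ 'd ^ 'd) \<Rightarrow> (nat list \<Rightarrow> real ^ 'd) \<Rightarrow> nat list \<Rightarrow> real ^ 'd \<Rightarrow> real ^ 'd"
where
  "word_map T \<omega> u = foldr (\<circ>) (map (\<lambda>j. letter_map T \<omega> (take j u)) [1..<Suc (length u)]) id"

definition matrix_system :: "(nat \<Rightarrow> nat) \<Rightarrow> (nat \<Rightarrow> nat \<Rightarrow> real ^ 'd ^ 'd) \<Rightarrow> bool" where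
  "matrix_system n T \<longleftrightarrow>
     (\<forall>k\<ge>1. n k \<ge> 2) \<and> (\<forall>k\<ge>1. \<forall>j\<in>{1..n k}. onorm ((*v) (T k j)) < 1)"

definition affine_family ::
  "(nat \<Rightarrow> nat) \<Rightarrow> (nat \<Rightarrow> nat \<Rightarrow> real ^ 'd ^ 'd) \<Rightarrow> (real ^ 'd) set
    \<Rightarrow> (nat list \<Rightarrow> (real ^ 'd) set) \<Rightarrow> bool"
where
  "affine_family n T J JJ \<longleftrightarrow>
     compact J \<and> interior J \<noteq> {} \<and>
     (\<forall>u\<in>all_words n. closed (JJ u) \<and> JJ u \<subseteq> J) \<and>
     JJ [] = J \<and>
     (\<forall>k\<ge>1. \<forall>u\<in>words n (k - 1). \<forall>j\<in>{1..n k}. JJ (u @ [j]) \<subseteq> JJ u) \<and>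
     (\<exists>\<omega>. \<forall>u\<in>all_words n. JJ u = word_map T \<omega> u ` J) \<and>
     (\<lambda>k. MAX u\<in>words n k. diameter (JJ u)) \<longlonglongrightarrow> 0"

definition affine_set :: "(nat \<Rightarrow> nat) \<Rightarrow> (nat list \<Rightarrow> (real ^ 'd) set) \<Rightarrow> (real ^ 'd) set" where
  "affine_set n JJ = (\<Inter>k\<in>{1..}. \<Union>u\<in>words n k. JJ u)"

definition alpha_plus :: "(nat \<Rightarrow> nat) \<Rightarrow> (nat \<Rightarrow> nat \<Rightarrow> real ^ 'd ^ 'd) \<Rightarrow> real" where
  "alpha_plus n T = Sup {singular_value 1 (T k i) | k i. k \<ge> 1 \<and> i \<in> {1..n k}}"

definition alpha_minus :: "(nat \<Rightarrow> nat) \<Rightarrow> (nat \<Rightarrow> nat \<Rightarrow> real ^ 'd ^ 'd) \<Rightarrow> real" where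
  "alpha_minus n T = Inf {singular_value CARD('d) (T k i) | k i. k \<ge> 1 \<and> i \<in> {1..n k}}"

definition stopping_words ::
  "(nat \<Rightarrow> nat) \<Rightarrow> (nat \<Rightarrow> nat \<Rightarrow> real ^ 'd ^ 'd) \<Rightarrow> real \<Rightarrow> real \<Rightarrow> nat list set"
where
  "stopping_words n T s \<epsilon> =
     (let m = min (nat \<lceil>s\<rceil>) CARD('d) in
       {u \<in> all_words n - {[]}.
          singular_value m (word_matrix T u) \<le> \<epsilon> \<and>
          \<epsilon> < singular_value m (word_matrix T (butlast u))})"

text \<open>
  The infimum is taken in the extended reals because the set can be empty (the \<open>n k\<close> may grow
  arbitrarily fast), in which case it is \<open>\<infinity>\<close>. When \<open>alpha_plus n T < 1\<close>, each set
  \<^term>\<open>stopping_words n T s \<epsilon>\<close> with \<open>s, \<epsilon> > 0\<close> is finite, as \<open>\<alpha>\<^sub>1(T\<^sub>u)\<close> is at most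
  the \<open>k\<close>-th power of \<open>alpha_plus n T\<close> for a word \<open>u\<close> of length \<open>k\<close>; so the sum is a
  genuine finite sum.
\<close>

definition s_star :: "(nat \<Rightarrow> nat) \<Rightarrow> (nat \<Rightarrow> nat \<Rightarrow> real ^ 'd ^ 'd) \<Rightarrow> ereal" where
  "s_star n T = Inf (ereal ` {s. s > 0 \<and>
     Limsup (at_right 0)
       (\<lambda>\<epsilon>. ereal (\<Sum>u\<in>stopping_words n T s \<epsilon>. singular_value_function s (word_matrix T u))) < \<infinity>})"

text \<open>
  Boundedness of the covering sets is required explicitly because the real-valued
  \<^const>\<open>diameter\<close> carries no information for unbounded sets.
  For bounded \<open>E\<close> in Euclidean space, such finite covers exist.
\<close>

definition covering_number :: "real \<Rightarrow> 'a::metric_space set \<Rightarrow> nat" where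
  "covering_number \<delta> E =
     (LEAST N. \<exists>C. finite C \<and> card C = N \<and> E \<subseteq> \<Union>C \<and> (\<forall>A\<in>C. bounded A \<and> diameter A \<le> \<delta>))"

definition upper_box_dim :: "'a::metric_space set \<Rightarrow> ereal" where
  "upper_box_dim E =
     Limsup (at_right 0) (\<lambda>\<delta>. ereal (ln (real (covering_number \<delta> E)) / (- ln \<delta>)))"

end

theory Submission
  imports Defs
begin

text \<open>
  For \<open>u\<close> in the stopping set, \<open>J\<^sub>u\<close> lies in an ellipsoid with semi-axes proportional to the
  singular values \<open>\<alpha>\<^sub>i\<close> of \<open>T\<^sub>u\<close>, so it is covered by a multiple of
  \<open>\<alpha>\<^sub>1 \<dots> \<alpha>\<^sub>m\<^sub>-\<^sub>1 / \<alpha>\<^sub>m\<^sup>m\<^sup>-\<^sup>1 = \<phi>\<^sup>s(T\<^sub>u) \<alpha>\<^sub>m\<^sup>-\<^sup>s\<close> sets of diameter of the order of \<open>\<alpha>\<^sub>m \<le> \<epsilon>\<close>.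
  The stopping rule and \<open>\<alpha>\<^sub>m(AB) \<ge> \<alpha>\<^sub>m(A) \<alpha>\<^sub>d(B)\<close> give \<open>\<alpha>\<^sub>m \<ge> \<alpha>\<^sub>- \<epsilon>\<close>. Summing over the
  stopping set, \<open>E\<close> has covering number at scale \<open>\<epsilon>\<close> at most a multiple of \<open>\<epsilon>\<^sup>-\<^sup>s\<close> whenever the sums of
  \<open>\<phi>\<^sup>s(T\<^sub>u)\<close> stay bounded.
\<close>

section \<open>Singular values\<close>

lemma linear_coeff_zero_of_quadratic_nonneg:
  fixes a b :: real
  assumes "\<And>t. 0 \<le> 2 * t * a + t\<^sup>2 * b"
  shows "a = 0"
proof (rule ccontr)
  assume "a \<noteq> 0"
  have "0 \<le> 2 * a + b" "0 \<le> - 2 * a + b"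
    using assms[of 1] assms[of "-1"] by auto
  then have b: "b \<ge> 0" by simp
  \<comment> \<open>The minimiser \<open>- a / b\<close> of the quadratic is avoided because
    \<open>b\<close> may be 0; with \<open>b + 1\<close> in the denominator the value is still
    negative.\<close>
  define t where "t = - a / (b + 1)"
  have "2 * t * a + t\<^sup>2 * b = - a\<^sup>2 * (b + 2) / (b + 1)\<^sup>2"
    using b unfolding t_def by (simp add: divide_simps power2_eq_square) algebra
  also have "\<dots> < 0"
    using b \<open>a \<noteq> 0\<close> by (intro divide_neg_pos mult_neg_pos) auto
  finally show False
    using assms[of t] by simp
qed

text \<open>A maximiser of the Rayleigh quotient is an eigenvector.\<close>

lemma self_adjoint_eigenvector:
  fixes f :: "'a::euclidean_space \<Rightarrow> 'a"
  assumes f: "linear f" and S: "subspace S" "S \<noteq> {0}" and inv: "f ` S \<subseteq> S"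
    and sa: "\<And>x y. f x \<bullet> y = x \<bullet> f y"
  obtains v c where "v \<in> S" "norm v = 1" "f v = c *\<^sub>R v"
proof -
  obtain w where w: "w \<in> S" "w \<noteq> 0"
    using S subspace_0 by blast
  have "compact (S \<inter> sphere 0 1)"
    using closed_subspace[OF S(1)] by (simp add: closed_Int_compact)
  moreover have "w /\<^sub>R norm w \<in> S \<inter> sphere 0 1"
    using w S by (simp add: subspace_scale)
  moreover have "continuous_on (S \<inter> sphere 0 1) (\<lambda>x. f x \<bullet> x)"
    by (intro continuous_on_inner continuous_on_id linear_continuous_on)
       (simp add: f linear_conv_bounded_linear[symmetric])
  ultimately obtain v where v: "v \<in> S" "norm v = 1"
    and max: "\<And>x. x \<in> S \<Longrightarrow> norm x = 1 \<Longrightarrow> f x \<bullet> x \<le> f v \<bullet> v"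
    using continuous_attains_sup[of "S \<inter> sphere 0 1" "\<lambda>x. f x \<bullet> x"] by force
  define c where "c = f v \<bullet> v"
  \<comment> \<open>As \<open>c\<close> is the maximum of the Rayleigh quotient on \<open>S\<close>,
    the quadratic form of \<open>g\<close> is nonnegative on \<open>S\<close> and vanishes at
    \<open>v\<close>. A zero of a semidefinite form lies in the kernel.\<close>
  define g where "g = (\<lambda>x. c *\<^sub>R x - f x)"
  have glin: "g (x + t *\<^sub>R y) = g x + t *\<^sub>R g y" for x y t
    by (simp add: g_def linear_add[OF f] linear_scale[OF f] algebra_simps)
  have gsa: "g x \<bullet> y = x \<bullet> g y" for x y
    by (simp add: g_def inner_diff_left inner_diff_right sa)
  have gS: "g x \<in> S" if "x \<in> S" for x
    using that inv S(1) unfolding g_def by (auto intro!: subspace_diff subspace_scale)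
  have gpos: "0 \<le> g x \<bullet> x" if "x \<in> S" for x
  proof (cases "x = 0")
    case False
    have "f (x /\<^sub>R norm x) \<bullet> (x /\<^sub>R norm x) \<le> c"
      unfolding c_def using that S False by (intro max) (auto simp: subspace_scale)
    then have "f x \<bullet> x \<le> c * (norm x)\<^sup>2"
      using False by (simp add: linear_scale[OF f] field_simps power2_eq_square)
    then show ?thesis
      by (simp add: g_def inner_diff_left power2_norm_eq_inner)
  qed simp
  have gv: "g v \<bullet> v = 0"
    using v by (simp add: g_def inner_diff_left c_def norm_eq_1)
  \<comment> \<open>Moving from \<open>v\<close> in the direction \<open>g v\<close> changes the
    form by \<open>2 * t * (g v \<bullet> g v)\<close> to first order, so nonnegativity for
    \<open>t\<close> of both signs forces \<open>g v = 0\<close>.\<close>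
  have "g v \<bullet> g v = 0"
  proof (rule linear_coeff_zero_of_quadratic_nonneg)
    fix t :: real
    have "0 \<le> g (v + t *\<^sub>R g v) \<bullet> (v + t *\<^sub>R g v)"
      using v gS S by (intro gpos) (auto intro!: subspace_add subspace_scale)
    also have "\<dots> = 2 * t * (g v \<bullet> g v) + t\<^sup>2 * (g (g v) \<bullet> g v)"
      by (simp add: glin inner_add_left inner_add_right gv gsa[of "g v" v] power2_eq_square algebra_simps)
    finally show "0 \<le> 2 * t * (g v \<bullet> g v) + t\<^sup>2 * (g (g v) \<bullet> g v)" .
  qed
  then have "f v = c *\<^sub>R v"
    by (simp add: g_def)
  then show thesis
    using that v by blast
qed

text \<open>Induction on the dimension: the orthogonal complement in \<open>S\<close> of an
  eigenvector is again invariant, because \<open>f\<close> is self-adjoint. Working with invariant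
  subspaces instead of the whole space makes this induction possible.\<close>

lemma self_adjoint_eigenbasis:
  fixes f :: "'a::euclidean_space \<Rightarrow> 'a"
  assumes f: "linear f" and sa: "\<And>x y. f x \<bullet> y = x \<bullet> f y"
    and "subspace S" "f ` S \<subseteq> S"
  shows "\<exists>B. B \<subseteq> S \<and> pairwise orthogonal B \<and> (\<forall>b\<in>B. norm b = 1) \<and> S \<subseteq> span B \<and>
           (\<forall>b\<in>B. \<exists>c. f b = c *\<^sub>R b)"
  using assms(3,4)
proof (induction "dim S" arbitrary: S rule: less_induct)
  case less
  show ?case
  proof (cases "S = {0}")
    case True
    then show ?thesis by (intro exI[of _ "{}"]) auto
  next
    case False
    obtain v c where v: "v \<in> S" "norm v = 1" "f v = c *\<^sub>R v"
      using self_adjoint_eigenvector[OF f less.prems(1) False less.prems(2) sa] by blast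
    define S' where "S' = {x \<in> S. x \<bullet> v = 0}"
    have S': "subspace S'"
      using less.prems(1) unfolding S'_def subspace_def by (auto simp: inner_add_left)
    have "S' \<subseteq> S" "v \<notin> S'"
      using v unfolding S'_def by auto
    then have "S' \<subset> S" using v by blast
    then have "dim S' < dim S"
      using S' less.prems(1) by (metis dim_psubset span_eq_iff)
    moreover have "f ` S' \<subseteq> S'"
      using less.prems(2) by (auto simp: S'_def sa v(3))
    ultimately obtain B where B: "B \<subseteq> S'" "pairwise orthogonal B" "\<forall>b\<in>B. norm b = 1"
      "S' \<subseteq> span B" "\<forall>b\<in>B. \<exists>c. f b = c *\<^sub>R b"
      using less.hyps[OF _ S'] by blast
    have "S \<subseteq> span (insert v B)"
    proof
      fix x assume x: "x \<in> S"
      have "x - (x \<bullet> v) *\<^sub>R v \<in> S'"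
        using x v less.prems(1) unfolding S'_def
        by (auto simp: inner_diff_left norm_eq_1 intro!: subspace_diff subspace_scale)
      then show "x \<in> span (insert v B)"
        using B(4) by (auto simp: span_insert)
    qed
    moreover have "pairwise orthogonal (insert v B)"
      using B unfolding pairwise_insert S'_def by (auto simp: orthogonal_def inner_commute)
    ultimately show ?thesis
      using B v \<open>S' \<subseteq> S\<close> by (intro exI[of _ "insert v B"]) auto
  qed
qed

section \<open>Characteristic polynomial and singular value decomposition\<close>

lemma matrix_diff_left: "(A - B) ** C = A ** C - B ** C"
  for A B :: "'a::comm_ring_1 ^ 'n ^ 'm"
  by (simp add: matrix_matrix_mult_def vec_eq_iff left_diff_distrib sum_subtractf)

lemma matrix_diff_right: "C ** (A - B) = C ** A - C ** B"
  for A B :: "'a::comm_ring_1 ^ 'n ^ 'm"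
  by (simp add: matrix_matrix_mult_def vec_eq_iff right_diff_distrib sum_subtractf)

text \<open>The embedding of real matrices into polynomial matrices. It is multiplicative, so
  similarity can be used under the determinant that defines \<open>charpoly\<close>.\<close>

definition const_matrix :: "real ^ 'd ^ 'd \<Rightarrow> real poly ^ 'd ^ 'd" where
  "const_matrix A = (\<chi> i j. [:A $ i $ j:])"

lemma const_matrix_mult: "const_matrix (A ** B) = const_matrix A ** const_matrix B"
  by (simp add: const_matrix_def matrix_matrix_mult_def vec_eq_iff sum_to_poly mult.commute)

lemma const_matrix_one: "const_matrix (mat 1) = mat 1"
  by (simp add: const_matrix_def mat_def vec_eq_iff)

text \<open>Similar matrices have the same characteristic polynomial, and for a diagonal matrix the
  determinant is a product. The determinant of \<open>P\<close> cancels because \<open>Q\<close>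
  inverts it over the polynomials as well.\<close>

lemma charpoly_eq_of_diagonalization:
  fixes A P Q :: "real ^ 'd ^ 'd" and l :: "'d \<Rightarrow> real"
  assumes PQ: "P ** Q = mat 1" and AP: "A ** P = P ** (\<chi> i j. if i = j then l i else 0)"
  shows "charpoly A = (\<Prod>i\<in>UNIV. [:- l i, 1:])"
proof -
  define X :: "real poly ^ 'd ^ 'd" where "X = mat [:0, 1:]"
  define D :: "real ^ 'd ^ 'd" where "D = (\<chi> i j. if i = j then l i else 0)"
  \<comment> \<open>\<open>X\<close> is a scalar matrix, hence central, which lets \<open>P\<close>
    pass through the difference of \<open>X\<close> and a constant matrix.\<close>
  have comm: "X ** M = M ** X" for M
    by (simp add: X_def matrix_matrix_mult_def mat_def vec_eq_iff if_distrib if_distribR mult.commute cong: if_cong)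
  have charpoly: "charpoly M = det (X - const_matrix M)" for M
    unfolding charpoly_def X_def const_matrix_def mat_def by (rule arg_cong[of _ _ det]) (simp add: vec_eq_iff)
  have "(X - const_matrix A) ** const_matrix P = const_matrix P ** (X - const_matrix D)"
    using comm AP by (simp add: matrix_diff_left matrix_diff_right D_def flip: const_matrix_mult)
  then have "charpoly A * det (const_matrix P) = det (const_matrix P) * charpoly D"
    by (metis charpoly det_mul)
  moreover have "det (const_matrix P) * det (const_matrix Q) = 1"
    by (simp add: PQ const_matrix_one flip: det_mul const_matrix_mult)
  ultimately have "charpoly A = charpoly D"
    by auto
  also have "\<dots> = (\<Prod>i\<in>UNIV. (X - const_matrix D) $ i $ i)"
    unfolding charpoly by (rule det_diagonal) (simp add: X_def const_matrix_def D_def mat_def)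
  also have "\<dots> = (\<Prod>i\<in>UNIV. [:- l i, 1:])"
    by (simp add: X_def const_matrix_def D_def mat_def)
  finally show ?thesis .
qed

lemma inner_matrix_vector_mult:
  fixes T :: "real ^ 'd ^ 'd"
  shows "(transpose T ** T *v x) \<bullet> y = (T *v x) \<bullet> (T *v y)"
  by (metis dot_lmul_matrix matrix_vector_mul_assoc transpose_matrix_vector)

text \<open>The bridge from the algebraic definition of \<open>singular_values\<close> to geometry.
  A unit eigenvector \<open>b\<close> of \<open>transpose T ** T\<close> has as eigenvalue the
  square of \<open>norm (T *v b)\<close>, so the roots of the characteristic polynomial are the
  squared lengths of the images of an orthonormal eigenbasis, with multiplicity. The images stay
  orthogonal, since \<open>(T *v a) \<bullet> (T *v b)\<close> is a multiple of
  \<open>a \<bullet> b\<close>.\<close>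

lemma singular_values_eq_map_norm:
  fixes T :: "real ^ 'd ^ 'd"
  obtains bs where "length bs = CARD('d)" "distinct bs" "pairwise orthogonal (set bs)"
    "\<And>b. b \<in> set bs \<Longrightarrow> norm b = 1"
    "pairwise (\<lambda>a b. orthogonal (T *v a) (T *v b)) (set bs)"
    "singular_values T = map (\<lambda>b. norm (T *v b)) bs"
    "sorted_wrt (\<ge>) (map (\<lambda>b. norm (T *v b)) bs)"
proof -
  define f where "f = (\<lambda>x. transpose T ** T *v x)"
  define g where "g = (\<lambda>x. norm (T *v x))"
  have "linear f"
    unfolding f_def by simp
  moreover have "f x \<bullet> y = x \<bullet> f y" for x y
    unfolding f_def by (metis inner_matrix_vector_mult inner_commute)
  ultimately obtain B where B: "pairwise orthogonal B" "\<forall>b\<in>B. norm b = 1"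
      "UNIV \<subseteq> span B" "\<forall>b\<in>B. \<exists>c. f b = c *\<^sub>R b"
    using self_adjoint_eigenbasis[of f UNIV] by auto
  have eigen: "f b = (g b)\<^sup>2 *\<^sub>R b" if b: "b \<in> B" for b
  proof -
    obtain c where c: "f b = c *\<^sub>R b"
      using B(4) b by blast
    have "c = f b \<bullet> b"
      using B(2) b by (simp add: c norm_eq_1)
    then show ?thesis
      using c by (simp add: f_def g_def inner_matrix_vector_mult power2_norm_eq_inner)
  qed
  have indep: "independent B"
    using B by (intro pairwise_orthogonal_independent) force+
  then have fin: "finite B"
    by (rule independent_imp_finite)
  have card: "card B = CARD('d)"
    using dim_span_eq_card_independent[OF indep] B(3) by (metis DIM_cart DIM_real dim_UNIV mult_1_right top.extremum_uniqueI)
  obtain h where h: "bij_betw h (UNIV :: 'd set) B"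
    using finite_same_card_bij[of "UNIV :: 'd set" B] fin card by auto
  have hB: "h i \<in> B" for i
    using h by (auto simp: bij_betw_def)
  have hinj: "h i = h j \<longleftrightarrow> i = j" for i j
    using h by (auto simp: bij_betw_def inj_def)
  have hh: "h i \<bullet> h j = (if i = j then 1 else 0)" for i j
  proof (cases "i = j")
    case True
    then show ?thesis using B(2) hB by (simp add: norm_eq_1)
  next
    case False
    then show ?thesis
      using B(1) hB[of i] hB[of j] hinj[of i j] by (auto simp: pairwise_def orthogonal_def)
  qed
  \<comment> \<open>The eigenbasis forms the columns of \<open>P\<close>, so orthonormality says
    that \<open>transpose P\<close> is its inverse.\<close>
  define P :: "real ^ 'd ^ 'd" where "P = (\<chi> i j. h j $ i)"
  have "(transpose P ** P) $ i $ j = h i \<bullet> h j" for i j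
    by (simp add: P_def matrix_matrix_mult_def transpose_def inner_vec_def)
  then have "transpose P ** P = mat 1"
    by (simp add: vec_eq_iff mat_def hh)
  then have PQ: "P ** transpose P = mat 1"
    by (simp add: matrix_left_right_inverse)
  have "((transpose T ** T) ** P) $ i $ j = f (h j) $ i" for i j
    by (simp add: f_def P_def matrix_matrix_mult_def matrix_vector_mult_def)
  then have AP: "(transpose T ** T) ** P = P ** (\<chi> i j. if i = j then (g (h i))\<^sup>2 else 0)"
    by (simp add: vec_eq_iff eigen hB P_def matrix_matrix_mult_def if_distrib mult.commute cong: if_cong)
  have "charpoly (transpose T ** T) = (\<Prod>i\<in>UNIV. [:- (g (h i))\<^sup>2, 1:])"
    by (rule charpoly_eq_of_diagonalization[OF PQ AP])
  also have "\<dots> = (\<Prod>b\<in>B. [:- (g b)\<^sup>2, 1:])"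
    by (rule prod.reindex_bij_betw[OF h])
  finally have "proots (charpoly (transpose T ** T)) = (\<Sum>b\<in>B. {#(g b)\<^sup>2#})"
    by (simp add: proots_prod)
  also have "\<dots> = image_mset (\<lambda>b. (g b)\<^sup>2) (mset_set B)"
    using fin by (induction B) auto
  finally have "image_mset sqrt (proots (charpoly (transpose T ** T))) = image_mset g (mset_set B)"
    by (simp add: multiset.map_comp o_def g_def)
  moreover obtain bs0 where bs0: "set bs0 = B" "distinct bs0"
    using finite_distinct_list[OF fin] by blast
  \<comment> \<open>Sorting is increasing, so the list handed over at the end is
    \<open>rev bs\<close>, in agreement with the \<open>rev\<close> in
    \<open>singular_values\<close>.\<close>
  define bs where "bs = sort_key g bs0"
  have "mset_set B = mset bs"
    using bs0 by (metis bs_def mset_set_set mset_sort)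
  moreover have "sort (map g bs) = map g bs"
    by (rule sorted_sort_id) (simp add: bs_def)
  ultimately have sv: "singular_values T = map g (rev bs)"
    unfolding singular_values_def by (simp add: rev_map flip: mset_map)
  have bs: "set bs = B" "distinct bs" "length bs = card B"
    using bs0 by (auto simp: bs_def distinct_card[symmetric])
  show thesis
  proof (rule that[of "rev bs"])
    show "pairwise (\<lambda>a b. orthogonal (T *v a) (T *v b)) (set (rev bs))"
      using B(1) by (auto simp: bs pairwise_def orthogonal_def eigen simp flip: inner_matrix_vector_mult f_def)
    show "sorted_wrt (\<ge>) (map (\<lambda>b. norm (T *v b)) (rev bs))"
      by (simp add: sorted_wrt_rev bs_def flip: g_def rev_map)
  qed (use B bs card sv in \<open>auto simp: g_def\<close>)
qed

text \<open>Right singular vectors, numbered from 1 as in \<open>singular_value\<close>. With both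
  the vectors and their images orthogonal, \<open>norm x\<close> and \<open>norm (T *v x)\<close>
  can be computed from the same coefficients by Pythagoras.\<close>

lemma singular_value_decomposition:
  fixes T :: "real ^ 'd ^ 'd"
  shows "\<exists>e :: nat \<Rightarrow> real ^ 'd.
    (\<forall>i\<in>{1..CARD('d)}. norm (e i) = 1 \<and> norm (T *v e i) = singular_value i T) \<and>
    (\<forall>i\<in>{1..CARD('d)}. \<forall>j\<in>{1..CARD('d)}. i \<noteq> j \<longrightarrow>
       e i \<bullet> e j = 0 \<and> (T *v e i) \<bullet> (T *v e j) = 0)"
proof -
  obtain bs where bs: "length bs = CARD('d)" "distinct bs" "pairwise orthogonal (set bs)"
    "\<And>b. b \<in> set bs \<Longrightarrow> norm b = 1"
    "pairwise (\<lambda>a b. orthogonal (T *v a) (T *v b)) (set bs)"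
    "singular_values T = map (\<lambda>b. norm (T *v b)) bs"
    using singular_values_eq_map_norm[of T] by metis
  have "bs ! (i - 1) \<bullet> bs ! (j - 1) = 0 \<and> (T *v bs ! (i - 1)) \<bullet> (T *v bs ! (j - 1)) = 0"
    if ij: "i \<in> {1..CARD('d)}" "j \<in> {1..CARD('d)}" "i \<noteq> j" for i j
  proof -
    have "bs ! (i - 1) \<in> set bs" "bs ! (j - 1) \<in> set bs" "bs ! (i - 1) \<noteq> bs ! (j - 1)"
      using ij bs(1,2) by (auto simp: nth_eq_iff_index_eq)
    then show ?thesis
      using bs(3,5) unfolding pairwise_def orthogonal_def by blast
  qed
  then show ?thesis
    using bs(1,4,6) by (intro exI[of _ "\<lambda>i. bs ! (i - 1)"]) (auto simp: singular_value_def)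
qed

lemma singular_value_mono:
  fixes T :: "real ^ 'd ^ 'd"
  assumes "1 \<le> i" "i \<le> j" "j \<le> CARD('d)"
  shows "singular_value j T \<le> singular_value i T"
proof -
  obtain bs where bs: "length bs = CARD('d)"
    "singular_values T = map (\<lambda>b. norm (T *v b)) bs"
    "sorted_wrt (\<ge>) (map (\<lambda>b. norm (T *v b)) bs)"
    using singular_values_eq_map_norm[of T] by metis
  show ?thesis
    using assms bs sorted_wrt_nth_less[OF bs(3), of "i - 1" "j - 1"]
    by (cases "i = j") (auto simp: singular_value_def)
qed

lemma singular_value_nonneg:
  fixes T :: "real ^ 'd ^ 'd"
  assumes "i \<in> {1..CARD('d)}"
  shows "0 \<le> singular_value i T"
  using assms singular_value_decomposition[of T] by (metis norm_ge_zero)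

section \<open>Orthonormal families and extremal subspaces of singular values\<close>

lemma orthonormal_expansion:
  fixes e :: "'i \<Rightarrow> 'a::real_inner"
  assumes fin: "finite I" and norm: "\<And>i. i \<in> I \<Longrightarrow> norm (e i) = 1"
    and orth: "\<And>i j. i \<in> I \<Longrightarrow> j \<in> I \<Longrightarrow> i \<noteq> j \<Longrightarrow> e i \<bullet> e j = 0"
    and x: "x \<in> span (e ` I)"
  shows "x = (\<Sum>i\<in>I. (x \<bullet> e i) *\<^sub>R e i)"
proof -
  have inj: "inj_on e I"
    using norm orth by (metis inj_onI norm_eq_1 zero_neq_one)
  obtain c where "x = (\<Sum>i\<in>I. c (e i) *\<^sub>R e i)"
    using x fin inj by (auto simp: span_finite sum.reindex)
  moreover have "(\<Sum>i\<in>I. c (e i) *\<^sub>R e i) \<bullet> e j = c (e j)" if "j \<in> I" for j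
  proof -
    have "(\<Sum>i\<in>I. c (e i) *\<^sub>R e i) \<bullet> e j = (\<Sum>i\<in>I. if i = j then c (e i) else 0)"
      unfolding inner_sum_left
      using norm orth that by (intro sum.cong) (auto simp: norm_eq_1)
    then show ?thesis
      using fin that by simp
  qed
  ultimately show ?thesis by simp
qed

lemma dim_span_orthonormal:
  fixes e :: "'i \<Rightarrow> 'a::euclidean_space"
  assumes norm: "\<And>i. i \<in> I \<Longrightarrow> norm (e i) = 1"
    and orth: "\<And>i j. i \<in> I \<Longrightarrow> j \<in> I \<Longrightarrow> i \<noteq> j \<Longrightarrow> e i \<bullet> e j = 0"
  shows "dim (span (e ` I)) = card I"
proof -
  have "pairwise orthogonal (e ` I)"
    using orth by (force simp: pairwise_def orthogonal_def)
  moreover have "0 \<notin> e ` I"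
    using norm by force
  ultimately have "independent (e ` I)"
    by (rule pairwise_orthogonal_independent)
  moreover have "inj_on e I"
    using norm orth by (metis inj_onI norm_eq_1 zero_neq_one)
  ultimately show ?thesis
    by (simp add: dim_eq_card_independent card_image)
qed

lemma norm_sum_orthogonal_squared:
  fixes e :: "'i \<Rightarrow> 'a::real_inner"
  assumes fin: "finite I"
    and orth: "\<And>i j. i \<in> I \<Longrightarrow> j \<in> I \<Longrightarrow> i \<noteq> j \<Longrightarrow> e i \<bullet> e j = 0"
  shows "(norm (\<Sum>i\<in>I. c i *\<^sub>R e i))\<^sup>2 = (\<Sum>i\<in>I. (c i)\<^sup>2 * (norm (e i))\<^sup>2)"
proof -
  have "(norm (\<Sum>i\<in>I. c i *\<^sub>R e i))\<^sup>2 = (\<Sum>i\<in>I. \<Sum>j\<in>I. c i * c j * (e j \<bullet> e i))"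
    by (simp add: power2_norm_eq_inner inner_sum_left inner_sum_right sum_distrib_left mult.assoc)
  also have "\<dots> = (\<Sum>i\<in>I. \<Sum>j\<in>I. if j = i then c i * c i * (e i \<bullet> e i) else 0)"
    using orth by (intro sum.cong) auto
  also have "\<dots> = (\<Sum>i\<in>I. (c i)\<^sup>2 * (norm (e i))\<^sup>2)"
    using fin by (simp add: power2_norm_eq_inner power2_eq_square[of "c _"])
  finally show ?thesis .
qed

text \<open>The subspaces of the Courant-Fischer principle: the spans of the right singular vectors
  with indices up to \<open>m\<close> and from \<open>m\<close> on. By Pythagoras the square of
  \<open>norm (T *v x)\<close> is the sum of the squared coefficients weighted by squared singular
  values, all at least, respectively at most, the \<open>m\<close>-th. The index \<open>m\<close>
  belongs to both spans, so their dimensions add up to \<open>CARD('d) + 1\<close>.\<close>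

lemma
  fixes T :: "real ^ 'd ^ 'd"
  assumes m: "m \<in> {1..CARD('d)}"
  shows expanding_subspace:
      "\<exists>V. subspace V \<and> dim V = m \<and> (\<forall>x\<in>V. singular_value m T * norm x \<le> norm (T *v x))"
    and contracting_subspace:
      "\<exists>W. subspace W \<and> dim W = CARD('d) + 1 - m \<and> (\<forall>x\<in>W. norm (T *v x) \<le> singular_value m T * norm x)"
proof -
  obtain e :: "nat \<Rightarrow> real ^ 'd" where e:
    "\<And>i. i \<in> {1..CARD('d)} \<Longrightarrow> norm (e i) = 1"
    "\<And>i j. i \<in> {1..CARD('d)} \<Longrightarrow> j \<in> {1..CARD('d)} \<Longrightarrow> i \<noteq> j \<Longrightarrow> e i \<bullet> e j = 0"
    "\<And>i. i \<in> {1..CARD('d)} \<Longrightarrow> norm (T *v e i) = singular_value i T"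
    "\<And>i j. i \<in> {1..CARD('d)} \<Longrightarrow> j \<in> {1..CARD('d)} \<Longrightarrow> i \<noteq> j \<Longrightarrow> (T *v e i) \<bullet> (T *v e j) = 0"
    using singular_value_decomposition[of T] by blast
  have dim: "dim (span (e ` I)) = card I" if I: "I \<subseteq> {1..CARD('d)}" for I
    using I e(1,2) by (intro dim_span_orthonormal) (metis subsetD)+
  have expand: "(norm x)\<^sup>2 = (\<Sum>i\<in>I. (x \<bullet> e i)\<^sup>2)"
    "(norm (T *v x))\<^sup>2 = (\<Sum>i\<in>I. (x \<bullet> e i)\<^sup>2 * (singular_value i T)\<^sup>2)"
    if I: "I \<subseteq> {1..CARD('d)}" and x: "x \<in> span (e ` I)" for I x
  proof -
    have fin: "finite I"
      using I finite_subset by blast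
    have eI: "\<And>i. i \<in> I \<Longrightarrow> norm (e i) = 1"
      "\<And>i. i \<in> I \<Longrightarrow> norm (T *v e i) = singular_value i T"
      "\<And>i j. i \<in> I \<Longrightarrow> j \<in> I \<Longrightarrow> i \<noteq> j \<Longrightarrow> e i \<bullet> e j = 0"
      "\<And>i j. i \<in> I \<Longrightarrow> j \<in> I \<Longrightarrow> i \<noteq> j \<Longrightarrow> (T *v e i) \<bullet> (T *v e j) = 0"
      using I e by (metis subsetD)+
    have x': "x = (\<Sum>i\<in>I. (x \<bullet> e i) *\<^sub>R e i)"
      using eI(1,3) x by (intro orthonormal_expansion fin) auto
    have "(norm (\<Sum>i\<in>I. (x \<bullet> e i) *\<^sub>R e i))\<^sup>2 = (\<Sum>i\<in>I. (x \<bullet> e i)\<^sup>2 * (norm (e i))\<^sup>2)"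
      using eI(3,4) by (intro norm_sum_orthogonal_squared fin) auto
    also have "\<dots> = (\<Sum>i\<in>I. (x \<bullet> e i)\<^sup>2)"
      using eI(1,2) by (intro sum.cong) auto
    finally show "(norm x)\<^sup>2 = (\<Sum>i\<in>I. (x \<bullet> e i)\<^sup>2)"
      using x' by simp
    have "T *v x = T *v (\<Sum>i\<in>I. (x \<bullet> e i) *\<^sub>R e i)"
      using x' by simp
    also have "\<dots> = (\<Sum>i\<in>I. (x \<bullet> e i) *\<^sub>R (T *v e i))"
      by (simp add: linear_sum linear_scale)
    finally have "(norm (T *v x))\<^sup>2 = (norm (\<Sum>i\<in>I. (x \<bullet> e i) *\<^sub>R (T *v e i)))\<^sup>2"
      by simp
    also have "\<dots> = (\<Sum>i\<in>I. (x \<bullet> e i)\<^sup>2 * (norm (T *v e i))\<^sup>2)"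
      using eI(3,4) by (intro norm_sum_orthogonal_squared fin) auto
    also have "\<dots> = (\<Sum>i\<in>I. (x \<bullet> e i)\<^sup>2 * (singular_value i T)\<^sup>2)"
      using eI(1,2) by (intro sum.cong) auto
    finally show "(norm (T *v x))\<^sup>2 = (\<Sum>i\<in>I. (x \<bullet> e i)\<^sup>2 * (singular_value i T)\<^sup>2)" .
  qed
  have nonneg: "0 \<le> singular_value i T" if "i \<in> {1..CARD('d)}" for i
    using singular_value_nonneg that by blast
  have "singular_value m T * norm x \<le> norm (T *v x)" if x: "x \<in> span (e ` {1..m})" for x
  proof (rule power2_le_imp_le)
    have I: "{1..m} \<subseteq> {1..CARD('d)}" using m by auto
    have "(singular_value m T * norm x)\<^sup>2 = (\<Sum>i\<in>{1..m}. (x \<bullet> e i)\<^sup>2 * (singular_value m T)\<^sup>2)"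
      by (simp add: power_mult_distrib expand(1)[OF I x] sum_distrib_left mult.commute)
    also have "\<dots> \<le> (norm (T *v x))\<^sup>2"
      unfolding expand(2)[OF I x] using m nonneg[OF m]
      by (intro sum_mono mult_left_mono power_mono singular_value_mono) auto
    finally show "(singular_value m T * norm x)\<^sup>2 \<le> (norm (T *v x))\<^sup>2" .
  qed simp
  then show "\<exists>V. subspace V \<and> dim V = m \<and> (\<forall>x\<in>V. singular_value m T * norm x \<le> norm (T *v x))"
    using dim[of "{1..m}"] m by (intro exI[of _ "span (e ` {1..m})"]) auto
  have "norm (T *v x) \<le> singular_value m T * norm x" if x: "x \<in> span (e ` {m..CARD('d)})" for x
  proof (rule power2_le_imp_le)
    have I: "{m..CARD('d)} \<subseteq> {1..CARD('d)}" using m by auto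
    have "(norm (T *v x))\<^sup>2 \<le> (\<Sum>i\<in>{m..CARD('d)}. (x \<bullet> e i)\<^sup>2 * (singular_value m T)\<^sup>2)"
      unfolding expand(2)[OF I x] using m nonneg
      by (intro sum_mono mult_left_mono power_mono singular_value_mono) auto
    also have "\<dots> = (singular_value m T * norm x)\<^sup>2"
      by (simp add: power_mult_distrib expand(1)[OF I x] sum_distrib_left mult.commute)
    finally show "(norm (T *v x))\<^sup>2 \<le> (singular_value m T * norm x)\<^sup>2" .
  qed (use nonneg[OF m] in simp)
  then show "\<exists>W. subspace W \<and> dim W = CARD('d) + 1 - m \<and> (\<forall>x\<in>W. norm (T *v x) \<le> singular_value m T * norm x)"
    using dim[of "{m..CARD('d)}"] m by (intro exI[of _ "span (e ` {m..CARD('d)})"]) auto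
qed

text \<open>\<open>V\<close> meets the contracting subspace nontrivially, by counting dimensions.\<close>

lemma singular_value_geI:
  fixes T :: "real ^ 'd ^ 'd"
  assumes m: "m \<in> {1..CARD('d)}" and V: "subspace V" "m \<le> dim V"
    and c: "\<And>x. x \<in> V \<Longrightarrow> c * norm x \<le> norm (T *v x)"
  shows "c \<le> singular_value m T"
proof -
  obtain W where W: "subspace W" "dim W = CARD('d) + 1 - m"
    "\<And>x. x \<in> W \<Longrightarrow> norm (T *v x) \<le> singular_value m T * norm x"
    using contracting_subspace[OF m] by blast
  have "dim {x + y |x y. x \<in> V \<and> y \<in> W} \<le> CARD('d)"
    using dim_subset_UNIV[of "{x + y |x y. x \<in> V \<and> y \<in> W}"] by simp
  then have "0 < dim (V \<inter> W)"
    using dim_sums_Int[OF V(1) W(1)] V(2) W(2) m by auto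
  then obtain x where x: "x \<in> V \<inter> W" "x \<noteq> 0"
    by (metis dim_eq_0 less_irrefl singletonI subsetI)
  then have "c * norm x \<le> singular_value m T * norm x"
    using c W(3) order_trans by blast
  moreover have "0 < norm x"
    using x by simp
  ultimately show ?thesis
    by (rule mult_right_le_imp_le)
qed

text \<open>For \<open>m = 1\<close> the contracting subspace has full dimension.\<close>

lemma norm_mult_le_singular_value_1:
  fixes T :: "real ^ 'd ^ 'd"
  shows "norm (T *v x) \<le> singular_value 1 T * norm x"
proof -
  obtain W where W: "subspace W" "dim W = CARD('d)"
    "\<And>x. x \<in> W \<Longrightarrow> norm (T *v x) \<le> singular_value 1 T * norm x"
    using contracting_subspace[of 1 T] by (auto simp: Suc_le_eq)
  then have "W = UNIV"
    by (metis DIM_cart DIM_real dim_eq_full mult_1_right span_eq_iff)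
  then show ?thesis
    using W(3) by blast
qed

text \<open>For \<open>m = CARD('d)\<close> it is the expanding subspace that is the whole
  space.\<close>

lemma norm_mult_ge_singular_value_CARD:
  fixes T :: "real ^ 'd ^ 'd"
  shows "singular_value CARD('d) T * norm x \<le> norm (T *v x)"
proof -
  obtain V where V: "subspace V" "dim V = CARD('d)"
    "\<And>x. x \<in> V \<Longrightarrow> singular_value CARD('d) T * norm x \<le> norm (T *v x)"
    using expanding_subspace[of "CARD('d)" T] by (auto simp: Suc_le_eq)
  then have "V = UNIV"
    by (metis DIM_cart DIM_real dim_eq_full mult_1_right span_eq_iff)
  then show ?thesis
    using V(3) by blast
qed

text \<open>If the smallest singular value of \<open>B\<close> is positive, \<open>B\<close> is
  onto, so the preimage under \<open>B\<close> of an expanding subspace of \<open>A\<close> still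
  has dimension at least \<open>m\<close>, and on it the two expansion factors multiply. Otherwise
  the left side is 0.\<close>

lemma singular_value_mult_ge:
  fixes A B :: "real ^ 'd ^ 'd"
  assumes m: "m \<in> {1..CARD('d)}"
  shows "singular_value m A * singular_value CARD('d) B \<le> singular_value m (A ** B)"
proof (cases "singular_value CARD('d) B = 0")
  case True
  then show ?thesis
    using singular_value_nonneg[OF m] by simp
next
  case False
  define b where "b = singular_value CARD('d) B"
  have b: "b > 0"
    using False singular_value_nonneg[of "CARD('d)" B] by (simp add: b_def Suc_le_eq)
  have Bge: "b * norm x \<le> norm (B *v x)" for x
    unfolding b_def by (rule norm_mult_ge_singular_value_CARD)
  have "B *v x = 0 \<longrightarrow> x = 0" for x
    using Bge[of x] b by (auto simp: mult_le_0_iff)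
  then have "inj ((*v) B)"
    by (simp add: linear_injective_0)
  then have surj: "surj ((*v) B)"
    by (simp add: linear_injective_imp_surjective)
  obtain V where V: "subspace V" "dim V = m"
    "\<And>x. x \<in> V \<Longrightarrow> singular_value m A * norm x \<le> norm (A *v x)"
    using expanding_subspace[OF m] by blast
  define V' where "V' = (*v) B -` V"
  have "subspace V'"
    unfolding V'_def by (intro linear_subspace_vimage V) simp
  moreover have "(*v) B ` V' = V"
    using surj unfolding V'_def by (rule surj_image_vimage_eq)
  then have "m \<le> dim V'"
    using dim_image_le[of "(*v) B" V'] V(2) by simp
  moreover have "singular_value m A * b * norm x \<le> norm ((A ** B) *v x)" if "x \<in> V'" for x
  proof -
    have "singular_value m A * (b * norm x) \<le> singular_value m A * norm (B *v x)"
      using Bge singular_value_nonneg[OF m] by (intro mult_left_mono)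
    also have "\<dots> \<le> norm (A *v (B *v x))"
      using that V(3) by (simp add: V'_def)
    finally show ?thesis
      by (simp add: matrix_vector_mul_assoc mult.assoc)
  qed
  ultimately show ?thesis
    unfolding b_def[symmetric] using singular_value_geI[OF m] by blast
qed

section \<open>Covering affine images\<close>

text \<open>Points are sorted into cells by the rounded values of all coordinates. The
  \<open>c i\<close> are arbitrary functions, so that the lemma serves both for singular directions
  and for the standard basis.\<close>

lemma coordinate_grid:
  fixes c :: "'i \<Rightarrow> 'a \<Rightarrow> real"
  assumes fin: "finite I" and R: "0 \<le> R" and w: "\<And>i. i \<in> I \<Longrightarrow> 0 < w i"
    and c: "\<And>x i. x \<in> J \<Longrightarrow> i \<in> I \<Longrightarrow> \<bar>c i x\<bar> \<le> R"
  shows "\<exists>P. finite P \<and> J \<subseteq> \<Union>P \<and> (\<forall>A\<in>P. A \<subseteq> J) \<and>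
    real (card P) \<le> (\<Prod>i\<in>I. 2 * R / w i + 1) \<and>
    (\<forall>A\<in>P. \<forall>x\<in>A. \<forall>y\<in>A. \<forall>i\<in>I. \<bar>c i x - c i y\<bar> \<le> w i)"
proof -
  \<comment> \<open>The shift by \<open>R\<close> makes the quotients nonnegative on
    \<open>J\<close>, so \<open>nat\<close> merges no two floors; the restriction to
    \<open>I\<close> puts \<open>k x\<close> into the finite set \<open>K\<close> of extensional
    functions.\<close>
  define k where "k = (\<lambda>x. \<lambda>i\<in>I. nat \<lfloor>(c i x + R) / w i\<rfloor>)"
  define K where "K = (\<Pi>\<^sub>E i\<in>I. {..nat \<lfloor>2 * R / w i\<rfloor>})"
  define P where "P = (\<lambda>f. {x \<in> J. k x = f}) ` K"
  have finK: "finite K"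
    unfolding K_def using fin by (intro finite_PiE) auto
  show ?thesis
  proof (intro exI[of _ P] conjI ballI)
    show "finite P"
      using finK by (simp add: P_def)
    have "k x \<in> K" if x: "x \<in> J" for x
    proof -
      have "(c i x + R) / w i \<le> 2 * R / w i" if i: "i \<in> I" for i
        using c[OF x i] w[OF i] by (intro divide_right_mono) auto
      then show ?thesis
        unfolding k_def K_def by (auto intro!: nat_mono floor_mono)
    qed
    then show "J \<subseteq> \<Union>P"
      by (auto simp: P_def)
    show "A \<subseteq> J" if "A \<in> P" for A
      using that by (auto simp: P_def)
    have "card P \<le> card K"
      unfolding P_def by (rule card_image_le[OF finK])
    also have "card K = (\<Prod>i\<in>I. nat \<lfloor>2 * R / w i\<rfloor> + 1)"
      unfolding K_def using fin by (simp add: card_PiE)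
    finally have "real (card P) \<le> (\<Prod>i\<in>I. real (nat \<lfloor>2 * R / w i\<rfloor> + 1))"
      by (metis of_nat_le_iff of_nat_prod)
    also have "\<dots> \<le> (\<Prod>i\<in>I. 2 * R / w i + 1)"
    proof (rule prod_mono, intro conjI)
      fix i assume "i \<in> I"
      then have "0 \<le> 2 * R / w i"
        using w R by (simp add: less_imp_le)
      then show "real (nat \<lfloor>2 * R / w i\<rfloor> + 1) \<le> 2 * R / w i + 1"
        by simp
    qed simp
    finally show "real (card P) \<le> (\<Prod>i\<in>I. 2 * R / w i + 1)" .
    show "\<bar>c i x - c i y\<bar> \<le> w i" if "A \<in> P" "x \<in> A" "y \<in> A" "i \<in> I" for A x y i
    proof -
      have xy: "x \<in> J" "y \<in> J" "k x = k y"
        using that by (auto simp: P_def)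
      have pos: "0 \<le> (c i x + R) / w i" "0 \<le> (c i y + R) / w i"
        using c[OF xy(1) that(4)] c[OF xy(2) that(4)] w[OF that(4)]
        by (intro divide_nonneg_pos; linarith)+
      have "nat \<lfloor>(c i x + R) / w i\<rfloor> = nat \<lfloor>(c i y + R) / w i\<rfloor>"
        using fun_cong[OF xy(3), of i] that(4) by (simp add: k_def)
      then have "\<lfloor>(c i x + R) / w i\<rfloor> = \<lfloor>(c i y + R) / w i\<rfloor>"
        using pos by (simp add: nat_eq_iff)
      then have "\<bar>(c i x + R) / w i - (c i y + R) / w i\<bar> \<le> 1"
        by linarith
      also have "(c i x + R) / w i - (c i y + R) / w i = (c i x - c i y) / w i"
        by (simp add: diff_divide_distrib add_divide_distrib)
      finally show ?thesis
        using w[OF that(4)] by (simp add: abs_divide divide_le_eq)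
    qed
  qed
qed

text \<open>
  In the coordinates given by the right singular vectors, cells of side proportional to
  \<open>1 / \<alpha>\<^sub>i\<close> in the directions \<open>i < m\<close>, and no subdivision in the other directions, are mapped to
  sets of diameter of the order of \<open>\<alpha>\<^sub>m\<close>.
\<close>

lemma affine_image_cover:
  fixes T :: "real ^ 'd ^ 'd"
  assumes m: "m \<in> {1..CARD('d)}" and pos: "0 < singular_value m T"
    and R: "0 < R" "J \<subseteq> cball 0 R"
  shows "\<exists>C. finite C \<and> (\<lambda>x. T *v x + a) ` J \<subseteq> \<Union>C \<and>
    real (card C) \<le> (\<Prod>i = 1..<m. 2 * singular_value i T / singular_value m T) \<and>
    (\<forall>A\<in>C. bounded A \<and> diameter A \<le> 2 * R * CARD('d) * singular_value m T)"
proof -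
  obtain e :: "nat \<Rightarrow> real ^ 'd" where e:
    "\<And>i. i \<in> {1..CARD('d)} \<Longrightarrow> norm (e i) = 1"
    "\<And>i j. i \<in> {1..CARD('d)} \<Longrightarrow> j \<in> {1..CARD('d)} \<Longrightarrow> i \<noteq> j \<Longrightarrow> e i \<bullet> e j = 0"
    "\<And>i. i \<in> {1..CARD('d)} \<Longrightarrow> norm (T *v e i) = singular_value i T"
    using singular_value_decomposition[of T] by blast
  define \<alpha> where "\<alpha> = (\<lambda>i. singular_value i T)"
  have \<alpha>_ge: "\<alpha> m \<le> \<alpha> i" if "i \<in> {1..<m}" for i
    using that m unfolding \<alpha>_def by (intro singular_value_mono) auto
  have \<alpha>_pos: "0 < \<alpha> i" if "i \<in> {1..<m}" for i
    using \<alpha>_ge[OF that] pos by (simp add: \<alpha>_def)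
  have \<alpha>_le: "\<alpha> i \<le> \<alpha> m" if "i \<in> {m..CARD('d)}" for i
    using that m unfolding \<alpha>_def by (intro singular_value_mono) auto
  have coord: "\<bar>x \<bullet> e i\<bar> \<le> norm x" if "i \<in> {1..CARD('d)}" for x i
    using Cauchy_Schwarz_ineq2[of x "e i"] e(1)[OF that] by simp
  have coordJ: "\<bar>x \<bullet> e i\<bar> \<le> R" if "x \<in> J" "i \<in> {1..CARD('d)}" for x i
    using coord[OF that(2), of x] R(2) that(1) by auto
  have coordJ': "\<bar>x \<bullet> e i\<bar> \<le> R" if "x \<in> J" "i \<in> {1..<m}" for x i
    using that m by (intro coordJ) auto
  \<comment> \<open>This width gives \<open>w i * \<alpha> i = 2 * R * \<alpha> m\<close>, the
    extent wanted after applying \<open>T\<close>, while \<open>2 * R / w i\<close> becomes the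
    ratio \<open>\<alpha> i / \<alpha> m\<close> to be counted.\<close>
  define w where "w = (\<lambda>i. 2 * R * \<alpha> m / \<alpha> i)"
  have w: "0 < w i" if "i \<in> {1..<m}" for i
    using \<alpha>_pos[OF that] pos R by (simp add: w_def \<alpha>_def)
  have "\<exists>P. finite P \<and> J \<subseteq> \<Union>P \<and> (\<forall>A\<in>P. A \<subseteq> J) \<and>
      real (card P) \<le> (\<Prod>i\<in>{1..<m}. 2 * R / w i + 1) \<and>
      (\<forall>A\<in>P. \<forall>x\<in>A. \<forall>y\<in>A. \<forall>i\<in>{1..<m}. \<bar>x \<bullet> e i - y \<bullet> e i\<bar> \<le> w i)"
    using w coordJ' R(1) by (intro coordinate_grid) simp_all
  then obtain P where P: "finite P" "J \<subseteq> \<Union>P" "\<forall>A\<in>P. A \<subseteq> J"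
    "real (card P) \<le> (\<Prod>i\<in>{1..<m}. 2 * R / w i + 1)"
    "\<forall>A\<in>P. \<forall>x\<in>A. \<forall>y\<in>A. \<forall>i\<in>{1..<m}. \<bar>x \<bullet> e i - y \<bullet> e i\<bar> \<le> w i"
    by blast
  have close: "norm ((T *v x + a) - (T *v y + a)) \<le> 2 * R * CARD('d) * \<alpha> m"
    if A: "A \<in> P" "x \<in> A" "y \<in> A" for A x y
  proof -
    define z where "z = x - y"
    have "dim (span (e ` {1..CARD('d)})) = DIM(real ^ 'd)"
      using e(1,2) by (subst dim_span_orthonormal) auto
    then have "span (e ` {1..CARD('d)}) = UNIV"
      using dim_eq_full span_span by metis
    then have "z = (\<Sum>i\<in>{1..CARD('d)}. (z \<bullet> e i) *\<^sub>R e i)"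
      using e by (intro orthonormal_expansion) auto
    then have "T *v z = T *v (\<Sum>i\<in>{1..CARD('d)}. (z \<bullet> e i) *\<^sub>R e i)"
      by simp
    also have "\<dots> = (\<Sum>i\<in>{1..CARD('d)}. (z \<bullet> e i) *\<^sub>R (T *v e i))"
      by (simp add: linear_sum linear_scale)
    finally have "norm (T *v z) \<le> (\<Sum>i\<in>{1..CARD('d)}. norm ((z \<bullet> e i) *\<^sub>R (T *v e i)))"
      by (simp only: norm_sum)
    also have "\<dots> = (\<Sum>i\<in>{1..CARD('d)}. \<bar>z \<bullet> e i\<bar> * \<alpha> i)"
      by (intro sum.cong) (auto simp: e \<alpha>_def)
    \<comment> \<open>For \<open>i < m\<close> the cell width gives the bound; in the other
      directions two points of \<open>J\<close> differ by at most \<open>2 * R\<close>, and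
      \<open>\<alpha> i \<le> \<alpha> m\<close>.\<close>
    also have "\<dots> \<le> (\<Sum>i\<in>{1..CARD('d)}. 2 * R * \<alpha> m)"
    proof (rule sum_mono)
      fix i assume i: "i \<in> {1..CARD('d)}"
      show "\<bar>z \<bullet> e i\<bar> * \<alpha> i \<le> 2 * R * \<alpha> m"
      proof (cases "i < m")
        case True
        then have im: "i \<in> {1..<m}" using i by simp
        have "\<bar>z \<bullet> e i\<bar> \<le> w i"
          using P(5) A im by (auto simp: z_def inner_diff_left)
        then show ?thesis
          using \<alpha>_pos[OF im] by (simp add: w_def field_simps)
      next
        case False
        have "x \<in> J" "y \<in> J"
          using P(3) A by auto
        then have "\<bar>z \<bullet> e i\<bar> \<le> 2 * R"
          using coordJ[OF _ i, of x] coordJ[OF _ i, of y] by (simp add: z_def inner_diff_left)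
        moreover have "0 \<le> \<alpha> i"
          using singular_value_nonneg[OF i] by (simp add: \<alpha>_def)
        ultimately show ?thesis
          using \<alpha>_le[of i] False i R(1) by (intro mult_mono) auto
      qed
    qed
    also have "\<dots> = 2 * R * CARD('d) * \<alpha> m"
      by simp
    finally show ?thesis
      by (simp add: z_def matrix_vector_mult_diff_distrib)
  qed
  define C where "C = (\<lambda>A. (\<lambda>x. T *v x + a) ` A) ` P"
  show ?thesis
  proof (intro exI[of _ C] conjI ballI)
    show "finite C"
      using P(1) by (simp add: C_def)
    show "(\<lambda>x. T *v x + a) ` J \<subseteq> \<Union>C"
      using P(2) by (auto simp: C_def)
    have "real (card C) \<le> real (card P)"
      unfolding C_def using card_image_le[OF P(1)] by simp
    also have "\<dots> \<le> (\<Prod>i = 1..<m. 2 * R / w i + 1)"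
      by (rule P(4))
    \<comment> \<open>Each factor is \<open>\<alpha> i / \<alpha> m + 1\<close>, and the 1 is
      absorbed since \<open>\<alpha> m \<le> \<alpha> i\<close>. This is the source of the power of
      2 in the final count.\<close>
    also have "\<dots> \<le> (\<Prod>i = 1..<m. 2 * \<alpha> i / \<alpha> m)"
    proof (rule prod_mono, intro conjI)
      fix i assume i: "i \<in> {1..<m}"
      have "0 < \<alpha> m" using pos by (simp add: \<alpha>_def)
      then show "2 * R / w i + 1 \<le> 2 * \<alpha> i / \<alpha> m"
        using \<alpha>_pos[OF i] \<alpha>_ge[OF i] R(1) by (simp add: w_def field_simps)
      show "0 \<le> 2 * R / w i + 1"
        using w[OF i] R(1) by (simp add: add_nonneg_nonneg less_imp_le)
    qed
    finally show "real (card C) \<le> (\<Prod>i = 1..<m. 2 * singular_value i T / singular_value m T)"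
      by (simp add: \<alpha>_def)
  next
    fix A' assume "A' \<in> C"
    then obtain A where A: "A \<in> P" "A' = (\<lambda>x. T *v x + a) ` A"
      by (auto simp: C_def)
    have "bounded A"
      using P(3) A(1) R(2) by (metis bounded_cball bounded_subset)
    then have "bounded ((*v) T ` A)"
      by (simp add: bounded_linear_image linear_linear)
    then show "bounded A'"
      unfolding A(2) using bounded_translation[of "(*v) T ` A" a]
      by (simp add: image_image add.commute)
    show "diameter A' \<le> 2 * R * CARD('d) * singular_value m T"
      using close[OF A(1)] pos R(1) unfolding A(2)
      by (intro diameter_le) (auto simp: \<alpha>_def)
  qed
qed

section \<open>Words and stopping sets\<close>

text \<open>Prepares inductions by appending a letter: the stopping rule compares a word with its
  \<open>butlast\<close>.\<close>

lemma snoc_in_all_words_iff: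
  "u @ [a] \<in> all_words n \<longleftrightarrow> u \<in> all_words n \<and> a \<in> {1..n (Suc (length u))}"
proof -
  have "(\<forall>j\<in>{1..Suc (length u)}. (u @ [a]) ! (j - 1) \<in> {1..n j}) \<longleftrightarrow>
      (\<forall>j\<in>{1..length u}. u ! (j - 1) \<in> {1..n j}) \<and> a \<in> {1..n (Suc (length u))}"
    by (auto simp: nth_append atLeastAtMostSuc_conv)
  then show ?thesis
    by (simp add: all_words_def words_def)
qed

lemma words_subset_all_words: "words n k \<subseteq> all_words n"
  by (auto simp: all_words_def)

lemma mem_words_length: "u \<in> all_words n \<Longrightarrow> u \<in> words n (length u)"
  by (auto simp: all_words_def words_def)

lemma finite_words: "finite (words n k)"
proof (rule finite_subset)
  show "words n k \<subseteq> {u. set u \<subseteq> (\<Union>j\<in>{1..k}. {1..n j}) \<and> length u = k}"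
  proof clarify
    fix u assume u: "u \<in> words n k"
    have "u ! i \<in> (\<Union>j\<in>{1..k}. {1..n j})" if "i < k" for i
      using u that by (intro UN_I[of "Suc i"]) (force simp: words_def)+
    then show "set u \<subseteq> (\<Union>j\<in>{1..k}. {1..n j}) \<and> length u = k"
      using u by (auto simp: words_def in_set_conv_nth)
  qed
qed (simp add: finite_lists_length_eq)

section \<open>Matrices and maps attached to words\<close>

lemma word_matrix_Nil: "word_matrix T [] = mat 1"
  by (simp add: word_matrix_def)

lemma word_matrix_snoc: "word_matrix T (u @ [a]) = word_matrix T u ** T (Suc (length u)) a"
proof -
  \<comment> \<open>The last factor enters as the start value of \<open>foldr\<close>; associativity
    moves it to the right of the product.\<close>
  have foldr: "foldr (**) xs A = foldr (**) xs (mat 1) ** A" for xs and A :: "real ^ 'd ^ 'd"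
    by (induction xs) (simp_all add: matrix_mul_assoc)
  have upt: "[1..<Suc (length (u @ [a]))] = [1..<Suc (length u)] @ [Suc (length u)]"
    by simp
  have eq: "map (\<lambda>j. T j ((u @ [a]) ! (j - 1))) [1..<Suc (length u)] = map (\<lambda>j. T j (u ! (j - 1))) [1..<Suc (length u)]"
    by (auto simp: nth_append)
  show ?thesis
    unfolding word_matrix_def upt map_append eq
    by (simp add: foldr[of _ "T (Suc (length u)) a"] del: upt_Suc)
qed

lemma word_map_snoc: "word_map T \<omega> (u @ [a]) = word_map T \<omega> u \<circ> letter_map T \<omega> (u @ [a])"
proof -
  have foldr: "foldr (\<circ>) xs f = foldr (\<circ>) xs id \<circ> f" for xs and f :: "real ^ 'd \<Rightarrow> real ^ 'd"
    by (induction xs) (simp_all add: o_assoc)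
  have upt: "[1..<Suc (length (u @ [a]))] = [1..<Suc (length u)] @ [Suc (length u)]"
    by simp
  have eq: "map (\<lambda>j. letter_map T \<omega> (take j (u @ [a]))) [1..<Suc (length u)] = map (\<lambda>j. letter_map T \<omega> (take j u)) [1..<Suc (length u)]"
    by auto
  show ?thesis
    unfolding word_map_def upt map_append eq
    by (simp add: foldr[of _ "letter_map T \<omega> (u @ [a])"] del: upt_Suc)
qed

text \<open>Composition multiplies the linear parts, and the translations only affect the constant.
  Hence the image of \<open>J\<close> is a translate of its image under
  \<open>word_matrix T u\<close>, whatever \<open>\<omega>\<close> is.\<close>

lemma word_map_affine: "\<exists>a. word_map T \<omega> u = (\<lambda>x. word_matrix T u *v x + a)"
proof (induction u rule: rev_induct)
  case Nil
  then show ?case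
    by (intro exI[of _ 0]) (simp add: word_map_def word_matrix_Nil id_def)
next
  case (snoc a u)
  then obtain b where "word_map T \<omega> u = (\<lambda>x. word_matrix T u *v x + b)" ..
  then show ?case
    by (intro exI[of _ "word_matrix T u *v \<omega> (u @ [a]) + b"])
      (simp add: fun_eq_iff word_map_snoc word_matrix_snoc letter_map_def
        matrix_vector_right_distrib matrix_vector_mul_assoc)
qed

lemma norm_word_matrix_le:
  assumes r: "0 \<le> r" "\<And>k i. k \<ge> 1 \<Longrightarrow> i \<in> {1..n k} \<Longrightarrow> singular_value 1 (T k i) \<le> r"
    and u: "u \<in> all_words n"
  shows "norm (word_matrix T u *v x) \<le> r ^ length u * norm x"
  using u
proof (induction u arbitrary: x rule: rev_induct)
  case Nil
  then show ?case by (simp add: word_matrix_Nil)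
next
  case (snoc a u)
  define A where "A = T (Suc (length u)) a"
  have u: "u \<in> all_words n" "a \<in> {1..n (Suc (length u))}"
    using snoc.prems by (simp_all add: snoc_in_all_words_iff)
  have le: "norm (word_matrix T (u @ [a]) *v x) \<le> r ^ length u * norm (A *v x)"
    using snoc.IH[OF u(1)] by (simp add: word_matrix_snoc A_def flip: matrix_vector_mul_assoc)
  have "norm (A *v x) \<le> r * norm x"
    using norm_mult_le_singular_value_1[of A x] r(2)[OF _ u(2)]
    by (metis A_def le_add1 mult_right_mono norm_ge_zero order_trans plus_1_eq_Suc)
  then have step: "r ^ length u * norm (A *v x) \<le> r ^ length u * (r * norm x)"
    using r(1) by (intro mult_left_mono) simp_all
  show ?case
    using order_trans[OF le step] by (simp add: mult_ac)
qed

text \<open>Each singular value is the length of the image of some unit vector.\<close>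

lemma singular_value_word_matrix_le:
  fixes T :: "nat \<Rightarrow> nat \<Rightarrow> real ^ 'd ^ 'd"
  assumes "0 \<le> r" "\<And>k i. k \<ge> 1 \<Longrightarrow> i \<in> {1..n k} \<Longrightarrow> singular_value 1 (T k i) \<le> r"
    and "u \<in> all_words n" "m \<in> {1..CARD('d)}"
  shows "singular_value m (word_matrix T u) \<le> r ^ length u"
proof -
  obtain e :: "real ^ 'd" where "norm e = 1" "norm (word_matrix T u *v e) = singular_value m (word_matrix T u)"
    using singular_value_decomposition[of "word_matrix T u"] assms(4) by blast
  then show ?thesis
    using norm_word_matrix_le[of r n T u e] assms by auto
qed

lemma singular_value_mat_1:
  assumes "m \<in> {1..CARD('d)}"
  shows "singular_value m (mat 1 :: real ^ 'd ^ 'd) = 1"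
proof -
  obtain e :: "real ^ 'd" where "norm e = 1" "norm (mat 1 *v e) = singular_value m (mat 1 :: real ^ 'd ^ 'd)"
    using singular_value_decomposition[of "mat 1 :: real ^ 'd ^ 'd"] assms by blast
  then show ?thesis
    by simp
qed

text \<open>Singular values decay geometrically with the length, so the value at
  \<open>butlast u\<close> can exceed \<open>\<epsilon>\<close> only for short words, and each
  length has finitely many words.\<close>

lemma finite_stopping_words:
  fixes T :: "nat \<Rightarrow> nat \<Rightarrow> real ^ 'd ^ 'd"
  assumes r: "0 \<le> r" "r < 1" "\<And>k i. k \<ge> 1 \<Longrightarrow> i \<in> {1..n k} \<Longrightarrow> singular_value 1 (T k i) \<le> r"
    and s: "0 < s" and \<epsilon>: "0 < \<epsilon>"
  shows "finite (stopping_words n T s \<epsilon>)"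
proof -
  define m where "m = min (nat \<lceil>s\<rceil>) CARD('d)"
  have m: "m \<in> {1..CARD('d)}"
    using s by (auto simp: m_def Suc_le_eq)
  obtain N where N: "r ^ N < \<epsilon>"
    using real_arch_pow_inv[OF \<epsilon> r(2)] by blast
  have "stopping_words n T s \<epsilon> \<subseteq> (\<Union>k\<le>N. words n k)"
  proof
    fix u assume "u \<in> stopping_words n T s \<epsilon>"
    then have u: "u \<in> all_words n" "u \<noteq> []" "\<epsilon> < singular_value m (word_matrix T (butlast u))"
      by (auto simp: stopping_words_def m_def Let_def)
    then have "butlast u \<in> all_words n"
      using snoc_in_all_words_iff[of "butlast u" "last u" n] by simp
    then have "singular_value m (word_matrix T (butlast u)) \<le> r ^ length (butlast u)"
      using r m by (intro singular_value_word_matrix_le)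
    \<comment> \<open>The exponent is \<open>length u - 1\<close> because the rule tests
      \<open>butlast u\<close>; words of length \<open>N\<close> itself are therefore still
      possible.\<close>
    then have "r ^ N < r ^ (length u - 1)"
      using u(3) N by simp
    then have "\<not> N \<le> length u - 1"
      using power_decreasing[of N "length u - 1" r] r(1,2) by auto
    then have "length u \<le> N"
      by linarith
    then show "u \<in> (\<Union>k\<le>N. words n k)"
      using mem_words_length[OF u(1)] by (intro UN_I) auto
  qed
  then show ?thesis
    by (rule finite_subset) (simp add: finite_words)
qed

text \<open>A point of the set lies in \<open>JJ u\<close> for words \<open>u\<close> of every
  positive length, and for a long one the singular value is at most \<open>\<epsilon>\<close>.
  Deleting last letters as long as it stays so leads to a stopping word, and nestedness keeps the
  point in the larger sets.\<close>

lemma stopping_words_cover: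
  fixes T :: "nat \<Rightarrow> nat \<Rightarrow> real ^ 'd ^ 'd"
  assumes r: "0 \<le> r" "r < 1" "\<And>k i. k \<ge> 1 \<Longrightarrow> i \<in> {1..n k} \<Longrightarrow> singular_value 1 (T k i) \<le> r"
    and s: "0 < s" and \<epsilon>: "0 < \<epsilon>" "\<epsilon> < 1"
    and nested: "\<And>k u j. k \<ge> 1 \<Longrightarrow> u \<in> words n (k - 1) \<Longrightarrow> j \<in> {1..n k} \<Longrightarrow> JJ (u @ [j]) \<subseteq> JJ u"
  shows "affine_set n JJ \<subseteq> (\<Union>u\<in>stopping_words n T s \<epsilon>. JJ u)"
proof
  fix x assume x: "x \<in> affine_set n JJ"
  define m where "m = min (nat \<lceil>s\<rceil>) CARD('d)"
  have m: "m \<in> {1..CARD('d)}"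
    using s by (auto simp: m_def Suc_le_eq)
  obtain N where N: "r ^ N < \<epsilon>"
    using real_arch_pow_inv[OF \<epsilon>(1) r(2)] by blast
  have step: "\<exists>v\<in>stopping_words n T s \<epsilon>. x \<in> JJ v"
    if "u \<in> all_words n" "x \<in> JJ u" "singular_value m (word_matrix T u) \<le> \<epsilon>" for u
    using that
  proof (induction u rule: rev_induct)
    \<comment> \<open>The descent cannot reach the empty word, whose singular value 1 is above
      \<open>\<epsilon>\<close>.\<close>
    case Nil
    then show ?case
      using \<epsilon> singular_value_mat_1[OF m] by (simp add: word_matrix_Nil)
  next
    case (snoc a u)
    have u: "u \<in> all_words n" "a \<in> {1..n (Suc (length u))}"
      using snoc.prems(1) by (simp_all add: snoc_in_all_words_iff)
    show ?case
    proof (cases "singular_value m (word_matrix T u) \<le> \<epsilon>")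
      case True
      have "JJ (u @ [a]) \<subseteq> JJ u"
        using nested[of "Suc (length u)" u a] u mem_words_length[OF u(1)] by simp
      then show ?thesis
        using snoc.IH[OF u(1) _ True] snoc.prems(2) by blast
    next
      case False
      then have "u @ [a] \<in> stopping_words n T s \<epsilon>"
        using snoc.prems by (simp add: stopping_words_def m_def Let_def)
      then show ?thesis
        using snoc.prems(2) by blast
    qed
  qed
  \<comment> \<open>Level \<open>Suc N\<close> replaces \<open>N\<close>, which may be 0, because
    \<open>affine_set\<close> intersects the levels from 1 on.\<close>
  have "r ^ Suc N < \<epsilon>"
    using N r power_decreasing[of N "Suc N" r] by simp
  moreover obtain u where u: "u \<in> words n (Suc N)" "x \<in> JJ u"
    using x by (auto simp: affine_set_def)
  moreover have "u \<in> all_words n" "length u = Suc N"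
    using u(1) words_subset_all_words by (auto simp: words_def)
  moreover have "singular_value m (word_matrix T u) \<le> r ^ length u"
    using \<open>u \<in> all_words n\<close> r m by (intro singular_value_word_matrix_le)
  ultimately show "x \<in> (\<Union>u\<in>stopping_words n T s \<epsilon>. JJ u)"
    using step[of u] by simp
qed

section \<open>Box dimension\<close>

lemma covering_number_le:
  assumes "finite C" "E \<subseteq> \<Union>C" "\<And>A. A \<in> C \<Longrightarrow> bounded A \<and> diameter A \<le> \<delta>"
  shows "covering_number \<delta> E \<le> card C"
  unfolding covering_number_def using assms by (intro Least_le exI[of _ C]) simp

text \<open>After taking logarithms the constant contributes \<open>ln L / - ln \<delta>\<close>,
  which tends to 0.\<close>

lemma upper_box_dim_le:
  assumes s: "0 \<le> s"
    and bound: "eventually (\<lambda>\<delta>. real (covering_number \<delta> E) \<le> K * \<delta> powr - s) (at_right 0)"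
  shows "upper_box_dim E \<le> ereal s"
proof -
  \<comment> \<open>\<open>K\<close> may be small or negative; \<open>L \<ge> 1\<close> has a
    nonnegative logarithm.\<close>
  define L where "L = max K 1"
  have L: "L \<ge> 1" "K \<le> L"
    by (auto simp: L_def)
  have "filterlim (\<lambda>\<delta>. - ln \<delta>) at_top (at_right (0::real))"
    using ln_at_0 by (simp add: filterlim_uminus_at_top)
  then have "((\<lambda>\<delta>. ln L / - ln \<delta> + s) \<longlongrightarrow> 0 + s) (at_right 0)"
    by (intro tendsto_add tendsto_const tendsto_divide_0[OF tendsto_const] filterlim_at_top_imp_at_infinity)
  then have lim: "((\<lambda>\<delta>. ereal (ln L / - ln \<delta> + s)) \<longlongrightarrow> ereal s) (at_right 0)"
    by simp
  have "eventually (\<lambda>\<delta>::real. \<delta> \<in> {0<..<1}) (at_right 0)"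
    by (rule eventually_at_right_real) simp
  with bound have "eventually (\<lambda>\<delta>. ereal (ln (real (covering_number \<delta> E)) / - ln \<delta>) \<le> ereal (ln L / - ln \<delta> + s)) (at_right 0)"
  proof eventually_elim
    case (elim \<delta>)
    then have \<delta>: "0 < \<delta>" "\<delta> < 1" "ln \<delta> < 0"
      by (auto simp: ln_less_zero)
    have "ln (real (covering_number \<delta> E)) \<le> ln L - s * ln \<delta>"
    proof (cases "covering_number \<delta> E = 0")
      \<comment> \<open>Here \<open>ln 0 = 0\<close>, and the right side is nonnegative because
        \<open>L \<ge> 1\<close>, \<open>s \<ge> 0\<close> and
        \<open>ln \<delta> < 0\<close>.\<close>
      case True
      then show ?thesis
        using mult_nonneg_nonpos[OF s less_imp_le[OF \<delta>(3)]] ln_ge_zero[OF L(1)]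
        by (simp del: ln_ge_zero_iff)
    next
      case False
      have "real (covering_number \<delta> E) \<le> L * \<delta> powr - s"
        using elim(1) L(2) mult_right_mono[of K L "\<delta> powr - s"] by simp
      then have "ln (real (covering_number \<delta> E)) \<le> ln (L * \<delta> powr - s)"
        using False by (subst ln_le_cancel_iff) auto
      also have "\<dots> = ln L - s * ln \<delta>"
        using L(1) \<delta>(1) by (simp add: ln_mult ln_powr)
      finally show ?thesis .
    qed
    then show ?case
      using \<delta> by (simp add: field_simps)
  qed
  then have "upper_box_dim E \<le> Limsup (at_right 0) (\<lambda>\<delta>. ereal (ln L / - ln \<delta> + s))"
    unfolding upper_box_dim_def by (rule Limsup_mono)
  also have "\<dots> = ereal s"
    by (rule lim_imp_Limsup[OF _ lim]) simp
  finally show ?thesis .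
qed

text \<open>A grid of side \<open>\<delta> / D\<close> in the standard coordinates: the
  \<open>D\<close> coordinate differences add up to at most \<open>\<delta>\<close>, and their sum
  dominates the Euclidean norm.\<close>

lemma upper_box_dim_le_DIM:
  fixes E :: "'a::euclidean_space set"
  assumes "bounded E"
  shows "upper_box_dim E \<le> ereal (real DIM('a))"
proof -
  define D where "D = real DIM('a)"
  have D: "D > 0"
    by (simp add: D_def)
  obtain R where R: "R > 0" "\<And>x. x \<in> E \<Longrightarrow> norm x \<le> R"
    using assms bounded_pos by blast
  have "real (covering_number \<delta> E) \<le> (2 * R * D + 1) ^ DIM('a) * \<delta> powr - D" if \<delta>: "\<delta> \<in> {0<..<1}" for \<delta>
  proof -
    have "\<exists>P. finite P \<and> E \<subseteq> \<Union>P \<and> (\<forall>A\<in>P. A \<subseteq> E) \<and>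
        real (card P) \<le> (\<Prod>b\<in>(Basis :: 'a set). 2 * R / (\<delta> / D) + 1) \<and>
        (\<forall>A\<in>P. \<forall>x\<in>A. \<forall>y\<in>A. \<forall>b\<in>Basis. \<bar>x \<bullet> b - y \<bullet> b\<bar> \<le> \<delta> / D)"
      using R \<delta> D by (intro coordinate_grid) (auto intro: order_trans[OF Basis_le_norm])
    then obtain P where P: "finite P" "E \<subseteq> \<Union>P" "\<forall>A\<in>P. A \<subseteq> E"
        "real (card P) \<le> (\<Prod>b\<in>(Basis :: 'a set). 2 * R / (\<delta> / D) + 1)"
        "\<forall>A\<in>P. \<forall>x\<in>A. \<forall>y\<in>A. \<forall>b\<in>Basis. \<bar>x \<bullet> b - y \<bullet> b\<bar> \<le> \<delta> / D"
      by blast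
    have "covering_number \<delta> E \<le> card P"
    proof (rule covering_number_le[OF P(1,2)])
      fix A assume A: "A \<in> P"
      have "norm (x - y) \<le> \<delta>" if "x \<in> A" "y \<in> A" for x y
      proof -
        have "norm (x - y) \<le> (\<Sum>b\<in>Basis. \<bar>(x - y) \<bullet> b\<bar>)"
          by (rule norm_le_l1)
        also have "\<dots> \<le> (\<Sum>b\<in>(Basis :: 'a set). \<delta> / D)"
          using P(5) A that by (intro sum_mono) (auto simp: inner_diff_left)
        also have "\<dots> = \<delta>"
          using D by (simp add: D_def)
        finally show ?thesis .
      qed
      then show "bounded A \<and> diameter A \<le> \<delta>"
        using assms P(3) A \<delta> by (auto intro: bounded_subset intro!: diameter_le)
    qed
    then have "real (covering_number \<delta> E) \<le> (2 * R / (\<delta> / D) + 1) ^ DIM('a)"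
      using P(4) by simp
    \<comment> \<open>As \<open>\<delta> < 1\<close>, the summand 1 is at most
      \<open>1 / \<delta>\<close>.\<close>
    also have "\<dots> \<le> ((2 * R * D + 1) / \<delta>) ^ DIM('a)"
      using R D \<delta> by (intro power_mono) (auto simp: field_simps)
    also have "\<dots> = (2 * R * D + 1) ^ DIM('a) * \<delta> powr - D"
      using \<delta> by (simp add: power_divide powr_minus D_def powr_realpow divide_inverse power_mult_distrib power_inverse)
    finally show ?thesis .
  qed
  then have "eventually (\<lambda>\<delta>. real (covering_number \<delta> E) \<le> (2 * R * D + 1) ^ DIM('a) * \<delta> powr - D) (at_right 0)"
    using eventually_at_right_real[of 0 1] by (rule eventually_mono[rotated]) auto
  then have "upper_box_dim E \<le> ereal D"
    using D by (intro upper_box_dim_le) auto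
  then show ?thesis
    by (simp add: D_def)
qed

section \<open>Covering the affine set along stopping words\<close>

text \<open>Before the last letter the singular value exceeds \<open>\<epsilon>\<close>, and
  appending one letter multiplies it by at least \<open>a\<close>.\<close>

lemma stopping_word_singular_value_ge:
  fixes T :: "nat \<Rightarrow> nat \<Rightarrow> real ^ 'd ^ 'd" and s :: real
  assumes a: "0 \<le> a" "\<And>k i. k \<ge> 1 \<Longrightarrow> i \<in> {1..n k} \<Longrightarrow> a \<le> singular_value CARD('d) (T k i)"
    and s: "0 < s" "s \<le> CARD('d)" and \<epsilon>: "0 < \<epsilon>"
    and u: "u \<in> stopping_words n T s \<epsilon>"
  shows "a * \<epsilon> \<le> singular_value (nat \<lceil>s\<rceil>) (word_matrix T u)"
proof -
  define m where "m = nat \<lceil>s\<rceil>"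
  have m: "m \<in> {1..CARD('d)}"
    using s by (auto simp: m_def Suc_le_eq nat_le_iff ceiling_le_iff)
  then have min: "min (nat \<lceil>s\<rceil>) CARD('d) = m"
    by (simp add: m_def)
  have u': "u \<in> all_words n" "u \<noteq> []" "\<epsilon> < singular_value m (word_matrix T (butlast u))"
    using u by (auto simp: stopping_words_def min Let_def)
  define v where "v = butlast u"
  define A where "A = T (Suc (length v)) (last u)"
  have uv: "u = v @ [last u]"
    using u'(2) by (simp add: v_def)
  then have "last u \<in> {1..n (Suc (length v))}"
    using u'(1) by (metis snoc_in_all_words_iff)
  then have "a \<le> singular_value CARD('d) A"
    using a(2)[of "Suc (length v)"] by (simp add: A_def)
  then have "\<epsilon> * a \<le> singular_value m (word_matrix T v) * singular_value CARD('d) A"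
    using u'(3) \<epsilon> a(1) by (intro mult_mono) (auto simp: v_def)
  also have "\<dots> \<le> singular_value m (word_matrix T u)"
    using singular_value_mult_ge[OF m, of "word_matrix T v" A] uv word_matrix_snoc[of T v "last u"]
    by (simp add: A_def)
  finally show ?thesis
    by (simp add: m_def mult.commute)
qed

text \<open>The covers of the sets \<open>JJ u\<close> over all stopping words are put together. For
  each word \<open>\<alpha> m \<le> \<epsilon>\<close> controls the diameters and
  \<open>a * \<epsilon> \<le> \<alpha> m\<close> the number of covering sets.\<close>

lemma covering_number_affine_set_le:
  fixes T :: "nat \<Rightarrow> nat \<Rightarrow> real ^ 'd ^ 'd" and s :: real
  assumes r: "0 \<le> r" "r < 1" "\<And>k i. k \<ge> 1 \<Longrightarrow> i \<in> {1..n k} \<Longrightarrow> singular_value 1 (T k i) \<le> r"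
    and a: "0 < a" "\<And>k i. k \<ge> 1 \<Longrightarrow> i \<in> {1..n k} \<Longrightarrow> a \<le> singular_value CARD('d) (T k i)"
    and nested: "\<And>k u j. k \<ge> 1 \<Longrightarrow> u \<in> words n (k - 1) \<Longrightarrow> j \<in> {1..n k} \<Longrightarrow> JJ (u @ [j]) \<subseteq> JJ u"
    and JJ: "\<And>u. u \<in> all_words n \<Longrightarrow> JJ u = word_map T \<omega> u ` J"
    and R: "0 < R" "J \<subseteq> cball 0 R"
    and s: "0 < s" "s \<le> CARD('d)" and \<epsilon>: "0 < \<epsilon>" "\<epsilon> < 1"
  shows "real (covering_number (2 * R * CARD('d) * \<epsilon>) (affine_set n JJ))
    \<le> 2 ^ (nat \<lceil>s\<rceil> - 1) * (a * \<epsilon>) powr - s *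
       (\<Sum>u\<in>stopping_words n T s \<epsilon>. singular_value_function s (word_matrix T u))"
proof -
  define m where "m = nat \<lceil>s\<rceil>"
  have m: "m \<in> {1..CARD('d)}"
    using s by (auto simp: m_def Suc_le_eq nat_le_iff ceiling_le_iff)
  define S where "S = stopping_words n T s \<epsilon>"
  define \<phi> where "\<phi> = (\<lambda>u. singular_value_function s (word_matrix T u))"
  have ex: "\<exists>C. finite C \<and> JJ u \<subseteq> \<Union>C \<and> real (card C) \<le> 2 ^ (m - 1) * (a * \<epsilon>) powr - s * \<phi> u \<and>
      (\<forall>A\<in>C. bounded A \<and> diameter A \<le> 2 * R * CARD('d) * \<epsilon>)" if u: "u \<in> S" for u
  proof -
    define \<alpha> where "\<alpha> = (\<lambda>i. singular_value i (word_matrix T u))"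
    have \<alpha>_ge: "a * \<epsilon> \<le> \<alpha> m"
      unfolding \<alpha>_def m_def
      using stopping_word_singular_value_ge[OF less_imp_le[OF a(1)] a(2) s \<epsilon>(1)] u by (simp add: S_def)
    moreover have "0 < a * \<epsilon>"
      using a \<epsilon> by simp
    ultimately have \<alpha>_pos: "0 < \<alpha> m"
      by linarith
    have \<alpha>_le: "\<alpha> m \<le> \<epsilon>" and uw: "u \<in> all_words n"
      using u m by (auto simp: S_def stopping_words_def Let_def \<alpha>_def m_def)
    obtain b where b: "word_map T \<omega> u = (\<lambda>x. word_matrix T u *v x + b)"
      using word_map_affine by blast
    obtain C where C: "finite C" "JJ u \<subseteq> \<Union>C" "real (card C) \<le> (\<Prod>i = 1..<m. 2 * \<alpha> i / \<alpha> m)"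
      "\<forall>A\<in>C. bounded A \<and> diameter A \<le> 2 * R * CARD('d) * \<alpha> m"
      using affine_image_cover[OF m \<alpha>_pos[unfolded \<alpha>_def] R, of b]
      unfolding \<alpha>_def JJ[OF uw] b by blast
    have "(\<Prod>i = 1..<m. \<alpha> i) \<ge> 0"
      using m by (intro prod_nonneg) (auto simp: \<alpha>_def intro!: singular_value_nonneg)
    moreover have \<phi>: "\<phi> u = (\<Prod>i = 1..<m. \<alpha> i) * \<alpha> m powr (s - real m + 1)"
      using s by (simp add: \<phi>_def singular_value_function_def \<alpha>_def m_def Let_def)
    ultimately have \<phi>_nonneg: "0 \<le> \<phi> u"
      by simp
    have "(\<Prod>i = 1..<m. 2 * \<alpha> i / \<alpha> m) = 2 ^ (m - 1) * (\<Prod>i = 1..<m. \<alpha> i) / \<alpha> m ^ (m - 1)"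
      by (simp add: prod_dividef prod.distrib)
    also have "\<dots> = 2 ^ (m - 1) * (\<Prod>i = 1..<m. \<alpha> i) * \<alpha> m powr - real (m - 1)"
      using \<alpha>_pos by (simp add: powr_minus powr_realpow divide_inverse)
    \<comment> \<open>The exponent is split so that its first part completes the product to
      \<open>\<phi> u\<close>; \<open>m \<ge> 1\<close> makes the subtraction of naturals
      exact.\<close>
    also have "- real (m - 1) = (s - real m + 1) + - s"
      using m by (simp add: of_nat_diff)
    also have "\<alpha> m powr ((s - real m + 1) + - s) = \<alpha> m powr (s - real m + 1) * \<alpha> m powr - s"
      by (rule powr_add)
    also have "2 ^ (m - 1) * (\<Prod>i = 1..<m. \<alpha> i) * (\<alpha> m powr (s - real m + 1) * \<alpha> m powr - s) =
        2 ^ (m - 1) * \<alpha> m powr - s * \<phi> u"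
      by (simp add: \<phi> mult_ac)
    \<comment> \<open>The exponent \<open>- s\<close> is negative, so the lower bound on
      \<open>\<alpha> m\<close> bounds its power from above.\<close>
    also have "\<dots> \<le> 2 ^ (m - 1) * (a * \<epsilon>) powr - s * \<phi> u"
      using \<alpha>_ge \<open>0 < a * \<epsilon>\<close> s(1) \<phi>_nonneg
      by (intro mult_right_mono mult_left_mono powr_mono2') auto
    finally have card: "real (card C) \<le> 2 ^ (m - 1) * (a * \<epsilon>) powr - s * \<phi> u"
      using C(3) by linarith
    have le: "2 * R * CARD('d) * \<alpha> m \<le> 2 * R * CARD('d) * \<epsilon>"
      using \<alpha>_le R(1) by (intro mult_left_mono) auto
    have small: "bounded A \<and> diameter A \<le> 2 * R * CARD('d) * \<epsilon>" if "A \<in> C" for A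
      using bspec[OF C(4) that] order_trans[OF _ le] by simp
    show ?thesis
      using C(1,2) card small by blast
  qed
  have "\<exists>C. \<forall>u\<in>S. finite (C u) \<and> JJ u \<subseteq> \<Union>(C u) \<and>
      real (card (C u)) \<le> 2 ^ (m - 1) * (a * \<epsilon>) powr - s * \<phi> u \<and>
      (\<forall>A\<in>C u. bounded A \<and> diameter A \<le> 2 * R * CARD('d) * \<epsilon>)"
    by (rule bchoice) (rule ballI, rule ex)
  then obtain C where "\<forall>u\<in>S. finite (C u) \<and> JJ u \<subseteq> \<Union>(C u) \<and>
      real (card (C u)) \<le> 2 ^ (m - 1) * (a * \<epsilon>) powr - s * \<phi> u \<and>
      (\<forall>A\<in>C u. bounded A \<and> diameter A \<le> 2 * R * CARD('d) * \<epsilon>)" ..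
  then have C: "\<And>u. u \<in> S \<Longrightarrow> finite (C u)" "\<And>u. u \<in> S \<Longrightarrow> JJ u \<subseteq> \<Union>(C u)"
    "\<And>u. u \<in> S \<Longrightarrow> real (card (C u)) \<le> 2 ^ (m - 1) * (a * \<epsilon>) powr - s * \<phi> u"
    "\<And>u A. u \<in> S \<Longrightarrow> A \<in> C u \<Longrightarrow> bounded A \<and> diameter A \<le> 2 * R * CARD('d) * \<epsilon>"
    by simp_all
  have fin: "finite S"
    unfolding S_def using r s(1) \<epsilon>(1) by (intro finite_stopping_words)
  have "affine_set n JJ \<subseteq> (\<Union>u\<in>S. JJ u)"
    unfolding S_def using r s(1) \<epsilon> nested by (intro stopping_words_cover)
  also have "\<dots> \<subseteq> (\<Union>u\<in>S. \<Union>(C u))"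
    by (rule UN_mono[OF subset_refl C(2)])
  also have "\<dots> = \<Union>(\<Union>u\<in>S. C u)"
    by auto
  finally have "affine_set n JJ \<subseteq> \<Union>(\<Union>u\<in>S. C u)" .
  then have "covering_number (2 * R * CARD('d) * \<epsilon>) (affine_set n JJ) \<le> card (\<Union>u\<in>S. C u)"
    using C(1,4) fin by (intro covering_number_le) auto
  also have "\<dots> \<le> (\<Sum>u\<in>S. card (C u))"
    by (rule card_UN_le[OF fin])
  finally have "real (covering_number (2 * R * CARD('d) * \<epsilon>) (affine_set n JJ)) \<le> (\<Sum>u\<in>S. real (card (C u)))"
    by (simp flip: of_nat_sum)
  also have "\<dots> \<le> (\<Sum>u\<in>S. 2 ^ (m - 1) * (a * \<epsilon>) powr - s * \<phi> u)"
    by (intro sum_mono C(3))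
  finally show ?thesis
    by (simp add: m_def S_def \<phi>_def sum_distrib_left)
qed

section \<open>Comparison of the box dimension with every exponent whose sums stay bounded\<close>

theorem theorem2p3:
  fixes n :: "nat \<Rightarrow> nat"
    and T :: "nat \<Rightarrow> nat \<Rightarrow> real ^ 'd ^ 'd"
    and J :: "(real ^ 'd) set"
    and JJ :: "nat list \<Rightarrow> (real ^ 'd) set"
    and E :: "(real ^ 'd) set"
  assumes "matrix_system n T"
    and "affine_family n T J JJ"
    and "E = affine_set n JJ"
    and "\<And>k i. k \<ge> 1 \<Longrightarrow> i \<in> {1..n k} \<Longrightarrow> invertible (T k i)"
    and "0 < alpha_minus n T"
    and "alpha_minus n T \<le> alpha_plus n T"
    and "alpha_plus n T < 1"
  shows "upper_box_dim E \<le> min (s_star n T) (ereal (real CARD('d)))"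
proof -
  define r where "r = alpha_plus n T"
  define a where "a = alpha_minus n T"
  have r: "0 \<le> r" "r < 1" and a: "0 < a"
    using assms(5-7) by (auto simp: r_def a_def)
  \<comment> \<open>The operator norm bound makes the set of largest singular values bounded above,
    so that its real \<open>Sup\<close> really is an upper bound.\<close>
  have sv1_le_1: "singular_value 1 (T k i) \<le> 1" if "k \<ge> 1" "i \<in> {1..n k}" for k i
  proof -
    obtain e :: "real ^ 'd" where "norm e = 1" "norm (T k i *v e) = singular_value 1 (T k i)"
      using singular_value_decomposition[of "T k i"] by (force simp: Suc_le_eq)
    moreover have "onorm ((*v) (T k i)) < 1"
      using assms(1) that by (auto simp: matrix_system_def)
    ultimately show ?thesis
      using onorm[of "(*v) (T k i)" e] by simp
  qed
  have sv1_le: "singular_value 1 (T k i) \<le> r" if "k \<ge> 1" "i \<in> {1..n k}" for k i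
    unfolding r_def alpha_plus_def using that sv1_le_1
    by (intro cSup_upper) (auto simp: bdd_above_def)
  have svd_ge: "a \<le> singular_value CARD('d) (T k i)" if "k \<ge> 1" "i \<in> {1..n k}" for k i
    unfolding a_def alpha_minus_def using that
    by (intro cInf_lower bdd_belowI[of _ 0]) (auto intro!: singular_value_nonneg simp: Suc_le_eq)
  have nested: "\<And>k u j. k \<ge> 1 \<Longrightarrow> u \<in> words n (k - 1) \<Longrightarrow> j \<in> {1..n k} \<Longrightarrow> JJ (u @ [j]) \<subseteq> JJ u"
    and JJ_subset: "\<And>u. u \<in> all_words n \<Longrightarrow> JJ u \<subseteq> J" and "compact J"
    using assms(2) unfolding affine_family_def by blast+
  have "\<exists>\<omega>. \<forall>u\<in>all_words n. JJ u = word_map T \<omega> u ` J"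
    using assms(2) unfolding affine_family_def by (elim conjE)
  then obtain \<omega> where JJ: "\<And>u. u \<in> all_words n \<Longrightarrow> JJ u = word_map T \<omega> u ` J"
    by (elim exE) (use that in simp)
  obtain R where R: "0 < R" "J \<subseteq> cball 0 R"
    using compact_imp_bounded[OF \<open>compact J\<close>] unfolding bounded_pos by force
  have "E \<subseteq> (\<Union>u\<in>words n 1. JJ u)"
    unfolding assms(3) affine_set_def by blast
  then have "E \<subseteq> J"
    using JJ_subset words_subset_all_words by blast
  then have "bounded E"
    using compact_imp_bounded[OF \<open>compact J\<close>] bounded_subset by blast
  then have le_d: "upper_box_dim E \<le> ereal (real CARD('d))"
    using upper_box_dim_le_DIM[of E] by simp
  have "upper_box_dim E \<le> ereal s"
    if s: "s > 0" and lim: "Limsup (at_right 0)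
       (\<lambda>\<epsilon>. ereal (\<Sum>u\<in>stopping_words n T s \<epsilon>. singular_value_function s (word_matrix T u))) < \<infinity>" for s
  proof (cases "s \<le> real CARD('d)")
    \<comment> \<open>Exponents above \<open>CARD('d)\<close> are settled by the trivial bound, so
      only the branch \<open>s \<le> CARD('d)\<close> of \<open>singular_value_function\<close> has
      to be estimated.\<close>
    case False
    then show ?thesis
      using order_trans[OF le_d, of "ereal s"] by simp
  next
    case True
    define F where "F = (\<lambda>\<epsilon>. \<Sum>u\<in>stopping_words n T s \<epsilon>. singular_value_function s (word_matrix T u))"
    have "Limsup (at_right 0) (\<lambda>\<epsilon>. ereal (F \<epsilon>)) \<noteq> \<infinity>"
      using lim by (simp add: F_def)
    then obtain M where M: "Limsup (at_right 0) (\<lambda>\<epsilon>. ereal (F \<epsilon>)) < ereal M"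
      unfolding less_PInf_Ex_of_nat by blast
    have "eventually (\<lambda>\<epsilon>. F \<epsilon> < M) (at_right 0)"
      using Limsup_lessD[OF M] by simp
    then obtain \<epsilon>0 where \<epsilon>0: "\<epsilon>0 > 0" "\<And>\<epsilon>. 0 < \<epsilon> \<Longrightarrow> \<epsilon> < \<epsilon>0 \<Longrightarrow> F \<epsilon> < M"
      unfolding eventually_at_right_field by blast
    \<comment> \<open>Stopping words at \<open>\<epsilon>\<close> give covering sets of diameter at
      most \<open>D * \<epsilon>\<close>. Scale \<open>\<delta>\<close> is therefore reached with
      \<open>\<epsilon> = \<delta> / D\<close>, and the rescaling only changes the constant
      \<open>K\<close>.\<close>
    define D where "D = 2 * R * CARD('d)"
    define K where "K = 2 ^ (nat \<lceil>s\<rceil> - 1) * (a / D) powr - s * M"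
    have D: "D > 0"
      using R(1) by (simp add: D_def)
    have bound: "real (covering_number \<delta> E) \<le> K * \<delta> powr - s"
      if \<delta>: "\<delta> \<in> {0<..<D * min \<epsilon>0 1}" for \<delta>
    proof -
      define \<epsilon> where "\<epsilon> = \<delta> / D"
      have "\<epsilon> < min \<epsilon>0 1"
        using \<delta> D by (simp add: \<epsilon>_def pos_divide_less_eq mult.commute del: min_less_iff_conj)
      then have \<epsilon>: "0 < \<epsilon>" "\<epsilon> < \<epsilon>0" "\<epsilon> < 1" "\<delta> = D * \<epsilon>"
        using \<delta> D by (auto simp: \<epsilon>_def)
      have "real (covering_number \<delta> E) \<le> 2 ^ (nat \<lceil>s\<rceil> - 1) * (a * \<epsilon>) powr - s * F \<epsilon>"
        unfolding \<epsilon>(4) D_def F_def assms(3)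
        by (rule covering_number_affine_set_le[where JJ = JJ and T = T and \<omega> = \<omega> and n = n,
              OF r sv1_le a svd_ge nested JJ R s True \<epsilon>(1,3)])
      also have "\<dots> \<le> 2 ^ (nat \<lceil>s\<rceil> - 1) * (a * \<epsilon>) powr - s * M"
        using \<epsilon>0(2)[OF \<epsilon>(1,2)] by (intro mult_left_mono) auto
      also have "a * \<epsilon> = a / D * \<delta>"
        by (simp add: \<epsilon>_def)
      also have "(a / D * \<delta>) powr - s = (a / D) powr - s * \<delta> powr - s"
        by (rule powr_mult)
      finally show ?thesis
        by (simp add: K_def mult_ac)
    qed
    have "eventually (\<lambda>\<delta>. \<delta> \<in> {0<..<D * min \<epsilon>0 1}) (at_right 0)"
      by (rule eventually_at_right_real) (use D \<epsilon>0(1) in simp)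
    then have "eventually (\<lambda>\<delta>. real (covering_number \<delta> E) \<le> K * \<delta> powr - s) (at_right 0)"
      using bound by (rule eventually_mono)
    then show ?thesis
      by (rule upper_box_dim_le[OF less_imp_le[OF s]])
  qed
  \<comment> \<open>If no exponent is admissible, the infimum in \<open>ereal\<close> is infinite
    and the inequality still holds.\<close>
  then have "upper_box_dim E \<le> s_star n T"
    unfolding s_star_def by (intro Inf_greatest) blast
  then show ?thesis
    using le_d by simp
qed

end
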